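(* Let $a>1/4$ and $h_c=2-1/a$. Consider the map $F_a(x,y)=\left(y,\dfrac{a-y+y^2}{x}\right)$ on $\mathbb{R}^{2,+}=\{(x,y):x>0,\,y>0\}$, the invariant conics $C_h=\{x^2+y^2-x-y+a-hxy=0\}$, $h\in(h_c,\infty)$, and the extensions to the real projective plane $\widetilde{C}_h=\{[x:y:z]:x^2+y^2-hxy-xz-yz+az^2=0\}$ and $\widetilde{F}_a([x:y:z])=[xy:az^2-yz+y^2:xz]$. Then: (a) For $h>2$, $C_h$ is a hyperbola, $F_{a|C_h}$ is conjugate to a translation, and there are two fixed points of $\widetilde{F}_{a|\widetilde{C}_h}$ at infinity, given by $[2:h\pm\sqrt{h^2-4}:0]$, an attractor and a repeller. (b) For $h=2$, $C_h$ is a parabola, $F_{a|C_h}$ is conjugate to a translation, and the point at infinity $[1:1:0]$ is a global attractor of $\widetilde{F}_{a|\widetilde{C}_h}$. (c) For $h_c<h<2$, $C_h$ is an ellipse, and $F_{a|C_h}$ is conjugate to a rotation with rotation number $$\theta(h)=\arg\left(\frac{h-i\sqrt{4-h^2}}{2}\right)\pmod{2\pi}.$$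
   Context: The function $V_a(x,y)=\dfrac{x^2+y^2-x-y+a}{xy}$ is a first integral of $F_a$ ($V_a\circ F_a=V_a$), so $F_a$ preserves the fibration of $\mathbb{R}^{2,+}$ by the curves $C_h=\{V_a=h\}$; $F_{a|C_h}$ denotes the restriction of $F_a$ to the part of $C_h$ in $\mathbb{R}^{2,+}$ (for $h>2$ this is one branch of the hyperbola). In (c) the rotation number is expressed as an angle in radians modulo $2\pi$. *)

theory Defs
  imports "HOL-Complex_Analysis.Complex_Analysis"
begin

subsection \<open>The map and its invariant conics\<close>

definition pos_quadrant :: "(real \<times> real) set" where
  "pos_quadrant = {(x, y). x > 0 \<and> y > 0}"

definition F :: "real \<Rightarrow> real \<times> real \<Rightarrow> real \<times> real" where
  "F a = (\<lambda>(x, y). (y, (a - y + y\<^sup>2) / x))"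

definition C :: "real \<Rightarrow> real \<Rightarrow> (real \<times> real) set" where
  "C a h = {(x, y). x\<^sup>2 + y\<^sup>2 - x - y + a - h * x * y = 0}"


subsection \<open>Types of conics\<close>

text \<open>
  Each type of conic is given by its Cartesian normal form up to a Euclidean motion.
  Note that \<^const>\<open>dist\<close> on \<^typ>\<open>real \<times> real\<close> is the Euclidean distance.
  Circles count as ellipses.
\<close>

definition congruent_sets :: "(real \<times> real) set \<Rightarrow> (real \<times> real) set \<Rightarrow> bool" where
  "congruent_sets S S' \<longleftrightarrow> (\<exists>T. (\<forall>p q. dist (T p) (T q) = dist p q) \<and> S' = T ` S)"

definition is_ellipse :: "(real \<times> real) set \<Rightarrow> bool" where
  "is_ellipse S \<longleftrightarrow>
     (\<exists>A B. A > 0 \<and> B > 0 \<and> congruent_sets {(x, y). x\<^sup>2 / A\<^sup>2 + y\<^sup>2 / B\<^sup>2 = 1} S)"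

definition is_hyperbola :: "(real \<times> real) set \<Rightarrow> bool" where
  "is_hyperbola S \<longleftrightarrow>
     (\<exists>A B. A > 0 \<and> B > 0 \<and> congruent_sets {(x, y). x\<^sup>2 / A\<^sup>2 - y\<^sup>2 / B\<^sup>2 = 1} S)"

definition is_parabola :: "(real \<times> real) set \<Rightarrow> bool" where
  "is_parabola S \<longleftrightarrow> (\<exists>k > 0. congruent_sets {(x, y). y = k * x\<^sup>2} S)"


subsection \<open>The real projective plane\<close>

definition proportional :: "real \<times> real \<times> real \<Rightarrow> real \<times> real \<times> real \<Rightarrow> bool" where
  "proportional u v \<longleftrightarrow> u \<noteq> 0 \<and> v \<noteq> 0 \<and> (\<exists>c. c \<noteq> 0 \<and> v = c *\<^sub>R u)"

quotient_type proj_plane = "real \<times> real \<times> real" / partial: proportional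
proof (rule part_equivpI)
  have "proportional (1, 0, 0) (1, 0, 0)"
    unfolding proportional_def by (simp add: zero_prod_def exI[of _ "1::real"])
  then show "\<exists>u. proportional u u" ..
  show "symp proportional"
  proof (rule sympI)
    fix u v assume "proportional u v"
    then obtain c where c: "u \<noteq> 0" "v \<noteq> 0" "c \<noteq> 0" "v = c *\<^sub>R u"
      by (auto simp: proportional_def)
    then have "u = inverse c *\<^sub>R v" by simp
    with c show "proportional v u"
      unfolding proportional_def by (metis inverse_nonzero_iff_nonzero)
  qed
  show "transp proportional"
  proof (rule transpI)
    fix u v w assume "proportional u v" "proportional v w"
    then obtain c d where "u \<noteq> 0" "w \<noteq> 0" "c \<noteq> 0" "d \<noteq> 0" "w = (d * c) *\<^sub>R u"
      by (auto simp: proportional_def)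
    then show "proportional u w"
      unfolding proportional_def by (metis mult_eq_0_iff)
  qed
qed

text \<open>The point with homogeneous coordinates \<open>[x:y:z]\<close>; meaningful only if these are not all zero.\<close>

definition proj_pt :: "real \<Rightarrow> real \<Rightarrow> real \<Rightarrow> proj_plane" where
  "proj_pt x y z = abs_proj_plane (x, y, z)"

text \<open>The plane carries the quotient topology of \<open>\<real>\<^sup>3\<close> without the origin.\<close>

instantiation proj_plane :: topological_space
begin

definition open_proj_plane :: "proj_plane set \<Rightarrow> bool" where
  "open_proj_plane U \<longleftrightarrow> open {v. v \<noteq> 0 \<and> abs_proj_plane v \<in> U}"

instance
proof
  have "{v :: real \<times> real \<times> real. v \<noteq> 0 \<and> abs_proj_plane v \<in> UNIV} = - {0}" by auto
  then show "open (UNIV :: proj_plane set)"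
    unfolding open_proj_plane_def by (simp only: open_Compl closed_singleton)
next
  fix S T :: "proj_plane set" assume "open S" "open T"
  moreover have "{v. v \<noteq> 0 \<and> abs_proj_plane v \<in> S \<inter> T} =
      {v. v \<noteq> 0 \<and> abs_proj_plane v \<in> S} \<inter> {v. v \<noteq> 0 \<and> abs_proj_plane v \<in> T}" by auto
  ultimately show "open (S \<inter> T)" unfolding open_proj_plane_def by (simp only: open_Int)
next
  fix K :: "proj_plane set set" assume "\<forall>S\<in>K. open S"
  moreover have "{v. v \<noteq> 0 \<and> abs_proj_plane v \<in> \<Union>K} =
      (\<Union>S\<in>K. {v. v \<noteq> 0 \<and> abs_proj_plane v \<in> S})" by auto
  ultimately show "open (\<Union>K)" unfolding open_proj_plane_def by (simp only: open_UN)
qed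

end

definition at_infty :: "proj_plane set" where
  "at_infty = {proj_pt x y 0 | x y. (x, y) \<noteq> (0, 0)}"

definition C_proj :: "real \<Rightarrow> real \<Rightarrow> proj_plane set" where
  "C_proj a h = {proj_pt x y z | x y z. (x, y, z) \<noteq> (0, 0, 0) \<and>
     x\<^sup>2 + y\<^sup>2 - h * x * y - x * z - y * z + a * z\<^sup>2 = 0}"

text \<open>
  The formula below is computed on an arbitrary representative. For \<open>a > 1/4\<close> it defines
  a point everywhere except at \<open>[1:0:0]\<close>, which lies on no \<^term>\<open>C_proj a h\<close>;
  see \<open>F_proj_proj_pt\<close>, \<open>F_proj_formula_nonzero\<close> and \<open>indeterminacy_notin_C_proj\<close>.
\<close>

definition F_proj :: "real \<Rightarrow> proj_plane \<Rightarrow> proj_plane" where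
  "F_proj a P = (case rep_proj_plane P of (x, y, z) \<Rightarrow>
     proj_pt (x * y) (a * z\<^sup>2 - y * z + y\<^sup>2) (x * z))"

lemma proportional_refl: "v \<noteq> 0 \<Longrightarrow> proportional v v"
  unfolding proportional_def by (metis scaleR_one zero_neq_one)

lemma proj_pt_eq_iff:
  assumes "(x, y, z) \<noteq> (0, 0, 0)" "(x', y', z') \<noteq> (0, 0, 0)"
  shows "proj_pt x y z = proj_pt x' y' z' \<longleftrightarrow>
    (\<exists>c. c \<noteq> 0 \<and> x' = c * x \<and> y' = c * y \<and> z' = c * z)"
proof -
  have nz: "(x, y, z) \<noteq> 0" "(x', y', z') \<noteq> 0" using assms by (auto simp: zero_prod_def)
  have "proportional (x, y, z) (x', y', z') \<longleftrightarrow> proj_pt x y z = proj_pt x' y' z'"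
    using Quotient_rel[OF Quotient_proj_plane, of "(x, y, z)" "(x', y', z')"]
      nz[THEN proportional_refl] by (simp add: proj_pt_def)
  then show ?thesis using nz by (simp add: proportional_def)
qed

lemma F_proj_proj_pt:
  assumes "(x, y, z) \<noteq> (0, 0, 0)"
    and "(x * y, a * z\<^sup>2 - y * z + y\<^sup>2, x * z) \<noteq> (0, 0, 0)"
  shows "F_proj a (proj_pt x y z) = proj_pt (x * y) (a * z\<^sup>2 - y * z + y\<^sup>2) (x * z)"
proof -
  obtain x' y' z' where r: "rep_proj_plane (proj_pt x y z) = (x', y', z')"
    by (cases "rep_proj_plane (proj_pt x y z)")
  have "(x, y, z) \<noteq> 0" using assms(1) by (auto simp: zero_prod_def)
  then have "proportional (x, y, z) (x', y', z')"
    using rep_abs_rsp[OF Quotient3_proj_plane, of "(x, y, z)" "(x, y, z)"] proportional_refl r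
    unfolding proj_pt_def by metis
  then obtain c where c: "c \<noteq> 0" "x' = c * x" "y' = c * y" "z' = c * z"
    by (auto simp: proportional_def)
  have eq: "x' * y' = c\<^sup>2 * (x * y)" "x' * z' = c\<^sup>2 * (x * z)"
    "a * z'\<^sup>2 - y' * z' + y'\<^sup>2 = c\<^sup>2 * (a * z\<^sup>2 - y * z + y\<^sup>2)"
    using c by (auto simp: algebra_simps power2_eq_square)
  have "proj_pt (x * y) (a * z\<^sup>2 - y * z + y\<^sup>2) (x * z) =
      proj_pt (x' * y') (a * z'\<^sup>2 - y' * z' + y'\<^sup>2) (x' * z')"
    unfolding eq by (subst proj_pt_eq_iff) (use assms(2) c(1) in \<open>auto intro!: exI[of _ "c\<^sup>2"]\<close>)
  then show ?thesis by (simp add: F_proj_def r)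
qed

lemma quadratic_pos:
  fixes a y z :: real
  assumes "a > 1 / 4" "(y, z) \<noteq> (0, 0)"
  shows "a * z\<^sup>2 - y * z + y\<^sup>2 > 0"
proof -
  have "a * z\<^sup>2 - y * z + y\<^sup>2 = (y - z / 2)\<^sup>2 + (a - 1 / 4) * z\<^sup>2"
    by (simp add: algebra_simps power2_eq_square)
  moreover have "\<dots> > 0"
  proof (cases "z = 0")
    case True then show ?thesis using assms by simp
  next
    case False then show ?thesis using assms by (intro add_nonneg_pos) auto
  qed
  ultimately show ?thesis by simp
qed

lemma F_proj_formula_nonzero:
  assumes "a > 1 / 4" "(x, y, z) \<noteq> (0, 0, 0)" "proj_pt x y z \<noteq> proj_pt 1 0 0"
  shows "(x * y, a * z\<^sup>2 - y * z + y\<^sup>2, x * z) \<noteq> (0, 0, 0)"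
proof -
  have "(y, z) \<noteq> (0, 0)"
  proof
    assume "(y, z) = (0, 0)"
    then have "proj_pt x y z = proj_pt 1 0 0"
      using assms(2) by (subst proj_pt_eq_iff) (auto intro!: exI[of _ "1 / x"])
    with assms(3) show False by simp
  qed
  with quadratic_pos[OF assms(1) this] show ?thesis by auto
qed

lemma indeterminacy_notin_C_proj: "proj_pt 1 0 0 \<notin> C_proj a h"
proof
  assume "proj_pt 1 0 0 \<in> C_proj a h"
  then obtain x y z where *: "(x, y, z) \<noteq> (0, 0, 0)" "proj_pt 1 0 0 = proj_pt x y z"
    "x\<^sup>2 + y\<^sup>2 - h * x * y - x * z - y * z + a * z\<^sup>2 = 0"
    by (auto simp: C_proj_def)
  then obtain c where "x = c * 1" "y = c * 0" "z = c * 0"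
    using proj_pt_eq_iff[of 1 0 0 x y z] by auto
  with * show False by simp
qed

lemma F_proj_extends_F:
  assumes "a > 1 / 4" "x \<noteq> 0"
  shows "F_proj a (proj_pt x y 1) = (case F a (x, y) of (x', y') \<Rightarrow> proj_pt x' y' 1)"
proof -
  have "F_proj a (proj_pt x y 1) = proj_pt (x * y) (a - y + y\<^sup>2) x"
    using F_proj_proj_pt[of x y 1 a] assms by simp
  also have "\<dots> = proj_pt y ((a - y + y\<^sup>2) / x) 1"
    using assms by (subst proj_pt_eq_iff) (auto intro!: exI[of _ "1 / x"])
  finally show ?thesis by (simp add: F_def)
qed


subsection \<open>Attractors and repellers\<close>

definition attractor :: "'a::topological_space set \<Rightarrow> ('a \<Rightarrow> 'a) \<Rightarrow> 'a \<Rightarrow> bool" where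
  "attractor X f p \<longleftrightarrow> f ` X \<subseteq> X \<and> p \<in> X \<and> f p = p \<and>
     (\<forall>V. open V \<and> p \<in> V \<longrightarrow> (\<exists>U. open U \<and> p \<in> U \<and> (\<forall>q\<in>X \<inter> U. \<forall>n. (f ^^ n) q \<in> V))) \<and>
     (\<exists>U. open U \<and> p \<in> U \<and> (\<forall>q\<in>X \<inter> U. (\<lambda>n. (f ^^ n) q) \<longlonglongrightarrow> p))"

definition repeller :: "'a::topological_space set \<Rightarrow> ('a \<Rightarrow> 'a) \<Rightarrow> 'a \<Rightarrow> bool" where
  "repeller X f p \<longleftrightarrow> bij_betw f X X \<and> attractor X (inv_into X f) p"

text \<open>
  Lyapunov stability is not part of the following notion: on a closed curve, a fixed point
  that attracts every orbit may well be stable on one side only, as happens for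
  \<^term>\<open>F_proj a\<close> on the projective closure of a parabola.
\<close>

definition global_attractor :: "'a::topological_space set \<Rightarrow> ('a \<Rightarrow> 'a) \<Rightarrow> 'a \<Rightarrow> bool" where
  "global_attractor X f p \<longleftrightarrow> f ` X \<subseteq> X \<and> p \<in> X \<and> f p = p \<and>
     (\<forall>q\<in>X. (\<lambda>n. (f ^^ n) q) \<longlonglongrightarrow> p)"


subsection \<open>Conjugacy to translations and rotations\<close>

definition conjugacy ::
  "'a::topological_space set \<Rightarrow> ('a \<Rightarrow> 'a) \<Rightarrow> 'b::topological_space set \<Rightarrow> ('b \<Rightarrow> 'b) \<Rightarrow>
   ('a \<Rightarrow> 'b) \<Rightarrow> ('b \<Rightarrow> 'a) \<Rightarrow> bool" where
  "conjugacy X f Y g \<phi> \<psi> \<longleftrightarrow>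
     f ` X \<subseteq> X \<and> g ` Y \<subseteq> Y \<and> homeomorphism X Y \<phi> \<psi> \<and> (\<forall>p\<in>X. \<phi> (f p) = g (\<phi> p))"

definition conj_to_translation :: "'a::topological_space set \<Rightarrow> ('a \<Rightarrow> 'a) \<Rightarrow> bool" where
  "conj_to_translation X f \<longleftrightarrow>
     (\<exists>\<tau>::real. \<tau> \<noteq> 0 \<and> (\<exists>\<phi> \<psi>. conjugacy X f UNIV (\<lambda>t. t + \<tau>) \<phi> \<psi>))"

definition counterclockwise :: "(complex \<Rightarrow> real \<times> real) \<Rightarrow> bool" where
  "counterclockwise \<psi> \<longleftrightarrow>
     (let \<gamma> = (\<lambda>(x, y). Complex x y) \<circ> \<psi> \<circ> circlepath 0 1
      in \<forall>w\<in>inside (path_image \<gamma>). winding_number \<gamma> w = 1)"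

text \<open>
  The rotation by \<open>\<theta>\<close> and the rotation by \<open>-\<theta>\<close> are conjugate by a reflection. The rotation
  number is determined modulo \<open>2\<pi>\<close>, and not merely up to sign, once the conjugacy is
  required to respect the counterclockwise orientations of the curve and of the unit circle.
\<close>

definition conj_to_rotation ::
  "(real \<times> real) set \<Rightarrow> (real \<times> real \<Rightarrow> real \<times> real) \<Rightarrow> real \<Rightarrow> bool" where
  "conj_to_rotation X f \<theta> \<longleftrightarrow>
     (\<exists>\<phi> \<psi>. conjugacy X f (sphere 0 1) (\<lambda>z. cis \<theta> * z) \<phi> \<psi> \<and> counterclockwise \<psi>)"

end

theory Submission
  imports Defs
begin

text \<open>
  The equation of the conic is quadratic in \<open>x\<close>, with product of roots \<open>y\<^sup>2 - y + a\<close> and sum of roots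
  \<open>h y + 1\<close>. The second coordinate of \<^term>\<open>F a (x, y)\<close> is the other root, so on \<^term>\<open>C a h\<close> the map is
  affine, \<open>(x, y) \<mapsto> (y, h y + 1 - x)\<close>, and its linear part has determinant 1 and trace \<open>h\<close>
  (\<open>F_affine_on_C\<close>, and \<open>F_proj_linear_on_C_proj\<close> in homogeneous coordinates). Everything
  follows from the normal form of this matrix, in which both the conic and the map are explicit.

  For \<open>h > 2\<close> the eigenvalues are real, \<open>m\<close> and \<open>n = 1 / m\<close>, and in coordinates \<open>r\<close>, \<open>s\<close> along the
  eigenvectors, centred at the fixed point \<open>(c, c)\<close>, the conic is \<open>r s = k\<close> and the map is
  \<open>(r, s) \<mapsto> (m r, n s)\<close>. Hence \<open>ln r\<close> conjugates the map to the translation by \<open>ln m\<close> on the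
  branch \<open>r > 0\<close>; that this branch is the part of the conic in the positive quadrant amounts to
  \<open>a > 1 / 4\<close> (\<open>pos_if_product_k\<close>). Near the point at infinity in the direction \<open>(1, m)\<close> the conic
  has the local parameter \<open>w = 1 / r\<close>, which the map multiplies by \<open>n\<close>: this is an attractor if
  \<open>|n| < 1\<close>. Exchanging \<open>m\<close> and \<open>n\<close> gives the other point at infinity, which attracts under the inverse.

  For \<open>h = 2\<close> the difference \<open>d = y - x\<close> parametrizes the parabola and the map is \<open>d \<mapsto> d + 1\<close>, so all
  orbits run off to the single point at infinity.

  For \<open>h < 2\<close> the matrix is conjugate to a rotation matrix with cosine \<open>h / 2\<close>, and the ellipse is the
  image of the unit circle under \<open>z \<mapsto> p z + q \<i> cnj z\<close>, up to a translation, with \<open>|q| < p\<close>. The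
  term with \<open>p\<close> dominates, so this parametrization is counterclockwise (\<open>counterclockwise_affine\<close>).
  This is what fixes the sign of the sine: the rotation is clockwise.
\<close>

section \<open>The map on an invariant conic\<close>

lemma mem_C: "(x, y) \<in> C a h \<longleftrightarrow> x\<^sup>2 + y\<^sup>2 - x - y + a - h * x * y = 0"
  by (simp add: C_def)

lemma mem_pos_quadrant: "(x, y) \<in> pos_quadrant \<longleftrightarrow> x > 0 \<and> y > 0"
  by (simp add: pos_quadrant_def)

text \<open>
  The second coordinate is \<open>(a - y + y\<^sup>2) / x\<close>, and \<open>a - y + y\<^sup>2\<close> is the product of the two roots of the
  equation of the conic regarded as a quadratic in \<open>x\<close>; their sum is \<open>h y + 1\<close>.
\<close>

lemma F_affine_on_C:
  assumes "(x, y) \<in> C a h" "x \<noteq> 0"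
  shows "F a (x, y) = (y, h * y + 1 - x)"
proof -
  have "a - y + y\<^sup>2 = (h * y + 1 - x) * x"
    using assms(1) by (simp add: mem_C algebra_simps power2_eq_square)
  then show ?thesis using assms(2) by (simp add: F_def)
qed

text \<open>
  The condition on \<open>c\<close> makes \<open>(c, c)\<close> both the centre of the conic and the fixed point of the affine map.
  The homogeneous form serves the affine conic (\<open>z = 1\<close>) and the projective one alike.
\<close>

lemma conic_about_centre:
  fixes c h :: real
  assumes "c * (2 - h) = 1"
  shows "x\<^sup>2 + y\<^sup>2 - h * x * y - x * z - y * z + a * z\<^sup>2 =
    (x - c * z)\<^sup>2 + (y - c * z)\<^sup>2 - h * (x - c * z) * (y - c * z) - (c - a) * z\<^sup>2"
proof -
  have "(x - c * z)\<^sup>2 + (y - c * z)\<^sup>2 - h * (x - c * z) * (y - c * z) - (c - a) * z\<^sup>2 =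
    x\<^sup>2 + y\<^sup>2 - h * x * y - c * (2 - h) * (x * z + y * z) + (c * (2 - h)) * c * z\<^sup>2 - (c - a) * z\<^sup>2"
    by (simp add: algebra_simps power2_eq_square)
  then show ?thesis unfolding assms by (simp add: algebra_simps)
qed

lemma mem_C_centre:
  assumes "c * (2 - h) = 1"
  shows "(x, y) \<in> C a h \<longleftrightarrow> (x - c)\<^sup>2 + (y - c)\<^sup>2 - h * (x - c) * (y - c) = c - a"
proof -
  have "x\<^sup>2 + y\<^sup>2 - x - y + a - h * x * y =
      (x - c)\<^sup>2 + (y - c)\<^sup>2 - h * (x - c) * (y - c) - (c - a)"
    using conic_about_centre[OF assms, of x y 1 a]
    unfolding power_one mult_1_right by linarith
  then show ?thesis unfolding mem_C by (simp only: right_minus_eq)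
qed

lemma centre_neg:
  fixes c h :: real
  assumes "c * (2 - h) = 1" "h > 2"
  shows "c < 0"
proof -
  have "c = - 1 / (h - 2)" using assms by (simp add: field_simps)
  then show ?thesis using assms(2) by simp
qed


section \<open>Types of the conics\<close>

text \<open>
  The two numbers \<open>u\<close>, \<open>v\<close> are the cosine and sine of the rotation, which turns the standard axes into
  those of the conic. Here these are always the diagonals, because the equation is symmetric in \<open>x\<close> and \<open>y\<close>.
\<close>

lemma congruent_sets_rigid_motion:
  fixes u v e e' :: real
  assumes "u\<^sup>2 + v\<^sup>2 = 1"
    and "\<And>x y. (e + u * x - v * y, e' + v * x + u * y) \<in> S' \<longleftrightarrow> (x, y) \<in> S"
  shows "congruent_sets S S'"
proof -
  define T where "T = (\<lambda>(x, y). (e + u * x - v * y, e' + v * x + u * y))"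
  have "dist (T p) (T q) = dist p q" for p q
  proof -
    obtain x y x' y' where pq: "p = (x, y)" "q = (x', y')" by (cases p, cases q)
    have "(u * x - v * y - (u * x' - v * y'))\<^sup>2 + (v * x + u * y - (v * x' + u * y'))\<^sup>2 =
        (u\<^sup>2 + v\<^sup>2) * ((x - x')\<^sup>2 + (y - y')\<^sup>2)"
      by (simp add: algebra_simps power2_eq_square)
    then show ?thesis using assms(1)
      by (simp add: pq T_def dist_Pair_Pair dist_real_def algebra_simps)
  qed
  moreover have "S' = T ` S"
  proof (intro equalityI subsetI)
    fix P assume "P \<in> S'"
    obtain x y where P: "P = (x, y)" by (cases P)
    define X Y where "X = u * (x - e) + v * (y - e')" and "Y = u * (y - e') - v * (x - e)"
    have "u * X - v * Y = (u\<^sup>2 + v\<^sup>2) * (x - e)" "v * X + u * Y = (u\<^sup>2 + v\<^sup>2) * (y - e')"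
      by (simp_all add: X_def Y_def algebra_simps power2_eq_square)
    then have "T (X, Y) = P" using assms(1) by (simp add: T_def P algebra_simps)
    moreover have "(X, Y) \<in> S"
      using \<open>P \<in> S'\<close> calculation assms(2)[of X Y] by (simp add: T_def)
    ultimately show "P \<in> T ` S" by force
  next
    fix P assume "P \<in> T ` S"
    then show "P \<in> S'" using assms(2) by (auto simp: T_def)
  qed
  ultimately show ?thesis unfolding congruent_sets_def by blast
qed

lemma diagonal_unit: "(1 / sqrt 2)\<^sup>2 + (1 / sqrt 2)\<^sup>2 = (1 :: real)"
  by (simp add: power_divide)

lemma mem_C_diagonal_axes:
  assumes "c * (2 - h) = 1"
  shows "(c + 1 / sqrt 2 * x - 1 / sqrt 2 * y, c + 1 / sqrt 2 * x + 1 / sqrt 2 * y) \<in> C a h \<longleftrightarrow>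
    (1 - h / 2) * x\<^sup>2 + (1 + h / 2) * y\<^sup>2 = c - a"
proof -
  define s :: real where "s = 1 / sqrt 2"
  have s: "s * s = 1 / 2" by (simp add: s_def)
  have "(s * x - s * y)\<^sup>2 + (s * x + s * y)\<^sup>2 - h * (s * x - s * y) * (s * x + s * y) =
    (s * s) * ((2 - h) * x\<^sup>2 + (2 + h) * y\<^sup>2)"
    by (simp add: algebra_simps power2_eq_square)
  also have "\<dots> = (1 - h / 2) * x\<^sup>2 + (1 + h / 2) * y\<^sup>2"
    unfolding s by (simp add: algebra_simps)
  finally have "(s * x - s * y)\<^sup>2 + (s * x + s * y)\<^sup>2 - h * (s * x - s * y) * (s * x + s * y) =
    (1 - h / 2) * x\<^sup>2 + (1 + h / 2) * y\<^sup>2" .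
  moreover have "c + s * x - s * y - c = s * x - s * y" "c + s * x + s * y - c = s * x + s * y"
    by simp_all
  ultimately show ?thesis unfolding mem_C_centre[OF assms] s_def[symmetric] by simp
qed

lemma is_ellipse_C:
  assumes "c * (2 - h) = 1" "- 2 < h" "h < 2" "c > a"
  shows "is_ellipse (C a h)"
proof -
  define A B where "A = sqrt ((c - a) / (1 - h / 2))" and "B = sqrt ((c - a) / (1 + h / 2))"
  have AB: "A\<^sup>2 = (c - a) / (1 - h / 2)" "B\<^sup>2 = (c - a) / (1 + h / 2)" "A > 0" "B > 0"
    using assms by (simp_all add: A_def B_def)
  have "congruent_sets {(x, y). x\<^sup>2 / A\<^sup>2 + y\<^sup>2 / B\<^sup>2 = 1} (C a h)"
  proof (rule congruent_sets_rigid_motion[OF diagonal_unit])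
    fix x y
    have "x\<^sup>2 / A\<^sup>2 + y\<^sup>2 / B\<^sup>2 = ((1 - h / 2) * x\<^sup>2 + (1 + h / 2) * y\<^sup>2) / (c - a)"
      unfolding AB by (simp add: add_divide_distrib mult.commute)
    then show "(c + 1 / sqrt 2 * x - 1 / sqrt 2 * y, c + 1 / sqrt 2 * x + 1 / sqrt 2 * y) \<in> C a h
        \<longleftrightarrow> (x, y) \<in> {(x, y). x\<^sup>2 / A\<^sup>2 + y\<^sup>2 / B\<^sup>2 = 1}"
      using assms(4) unfolding mem_C_diagonal_axes[OF assms(1)] by auto
  qed
  with AB show ?thesis unfolding is_ellipse_def by blast
qed

lemma is_hyperbola_C:
  assumes "c * (2 - h) = 1" "2 < h" "c < a"
  shows "is_hyperbola (C a h)"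
proof -
  define A B where "A = sqrt ((a - c) / (h / 2 - 1))" and "B = sqrt ((a - c) / (h / 2 + 1))"
  have AB: "A\<^sup>2 = (a - c) / (h / 2 - 1)" "B\<^sup>2 = (a - c) / (h / 2 + 1)" "A > 0" "B > 0"
    using assms by (simp_all add: A_def B_def)
  have "congruent_sets {(x, y). x\<^sup>2 / A\<^sup>2 - y\<^sup>2 / B\<^sup>2 = 1} (C a h)"
  proof (rule congruent_sets_rigid_motion[OF diagonal_unit])
    fix x y
    have "x\<^sup>2 / A\<^sup>2 = (h / 2 - 1) * x\<^sup>2 / (a - c)" "y\<^sup>2 / B\<^sup>2 = (h / 2 + 1) * y\<^sup>2 / (a - c)"
      unfolding AB by (simp_all only: divide_divide_eq_right mult.commute)
    then have "x\<^sup>2 / A\<^sup>2 - y\<^sup>2 / B\<^sup>2 = ((h / 2 - 1) * x\<^sup>2 - (h / 2 + 1) * y\<^sup>2) / (a - c)"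
      by (simp only: diff_divide_distrib)
    also have "\<dots> = 1 \<longleftrightarrow> (1 - h / 2) * x\<^sup>2 + (1 + h / 2) * y\<^sup>2 = c - a"
      using assms(3) by (simp add: algebra_simps) linarith
    finally show "(c + 1 / sqrt 2 * x - 1 / sqrt 2 * y, c + 1 / sqrt 2 * x + 1 / sqrt 2 * y) \<in> C a h
        \<longleftrightarrow> (x, y) \<in> {(x, y). x\<^sup>2 / A\<^sup>2 - y\<^sup>2 / B\<^sup>2 = 1}"
      unfolding mem_C_diagonal_axes[OF assms(1)] by simp
  qed
  with AB show ?thesis unfolding is_hyperbola_def by blast
qed

lemma is_parabola_C: "is_parabola (C a 2)"
proof -
  have unit: "(1 / sqrt 2)\<^sup>2 + (- (1 / sqrt 2))\<^sup>2 = (1 :: real)"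
    by (simp add: power_divide)
  \<comment> \<open>The rotation takes the direction of the positive second axis to that of \<open>(1, 1)\<close>, in which the
    parabola opens, and the image of the vertex is the point \<open>(a / 2, a / 2)\<close> of the conic.\<close>
  have "congruent_sets {(x, y). y = sqrt 2 * x\<^sup>2} (C a 2)"
  proof (rule congruent_sets_rigid_motion[OF unit])
    fix x y :: real
    define s :: real where "s = 1 / sqrt 2"
    have s: "s * s = 1 / 2" "2 * s = sqrt 2" by (simp_all add: s_def real_div_sqrt)
    have "(a / 2 + s * x - - s * y)\<^sup>2 + (a / 2 + - s * x + s * y)\<^sup>2
        - (a / 2 + s * x - - s * y) - (a / 2 + - s * x + s * y) + a
        - 2 * (a / 2 + s * x - - s * y) * (a / 2 + - s * x + s * y) =
        4 * (s * s) * x\<^sup>2 - 2 * s * y"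
      by (simp add: algebra_simps power2_eq_square)
    also have "\<dots> = 2 * s * (2 * s * x\<^sup>2 - y)" by (simp add: algebra_simps)
    also have "\<dots> = sqrt 2 * (sqrt 2 * x\<^sup>2 - y)" by (simp only: s)
    finally show "(a / 2 + 1 / sqrt 2 * x - - (1 / sqrt 2) * y,
        a / 2 + - (1 / sqrt 2) * x + 1 / sqrt 2 * y) \<in> C a 2 \<longleftrightarrow>
        (x, y) \<in> {(x, y). y = sqrt 2 * x\<^sup>2}"
      unfolding mem_C s_def by auto
  qed
  then show ?thesis unfolding is_parabola_def by (intro exI[of _ "sqrt 2"]) simp
qed


section \<open>Conjugacies on the affine conics\<close>

text \<open>
  The form in which all conjugacies arise below: \<open>\<psi>\<close> is an explicit parametrization of the curve along
  which the map is a translation or rotation of the parameter, so that invariance of the curve comes for free.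
\<close>

lemma conjugacy_parametrization:
  assumes "continuous_on X \<phi>" "continuous_on Y \<psi>"
    and "\<And>p. p \<in> X \<Longrightarrow> \<phi> p \<in> Y \<and> \<psi> (\<phi> p) = p"
    and "\<And>t. t \<in> Y \<Longrightarrow> \<psi> t \<in> X \<and> \<phi> (\<psi> t) = t"
    and "\<And>t. t \<in> Y \<Longrightarrow> g t \<in> Y \<and> f (\<psi> t) = \<psi> (g t)"
  shows "conjugacy X f Y g \<phi> \<psi>"
proof -
  have "homeomorphism X Y \<phi> \<psi>"
    using assms(1-4) by (intro homeomorphismI) auto
  moreover have "\<phi> (f p) = g (\<phi> p) \<and> f p \<in> X" if "p \<in> X" for p
    using assms(3)[OF that] assms(4,5) by metis
  ultimately show ?thesis using assms(5) unfolding conjugacy_def by auto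
qed

lemma conj_to_translation_parabola:
  assumes "a > 1 / 4"
  shows "conj_to_translation (C a 2 \<inter> pos_quadrant) (F a)"
proof -
  \<comment> \<open>On the parabola \<open>y - x = d\<close> forces \<open>x + y = d\<^sup>2 + a\<close>.\<close>
  define \<psi> where "\<psi> = (\<lambda>d :: real. ((d\<^sup>2 - d + a) / 2, (d\<^sup>2 + d + a) / 2))"
  have C: "\<psi> d \<in> C a 2" for d
    by (simp add: \<psi>_def mem_C field_simps power2_eq_square)
  have pos: "\<psi> d \<in> pos_quadrant" for d
    using quadratic_pos[OF assms, of d 1] quadratic_pos[OF assms, of "- d" 1]
    by (simp add: \<psi>_def mem_pos_quadrant algebra_simps)
  have "conjugacy (C a 2 \<inter> pos_quadrant) (F a) UNIV (\<lambda>t. t + 1) (\<lambda>p. snd p - fst p) \<psi>"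
  proof (rule conjugacy_parametrization)
    show "continuous_on (C a 2 \<inter> pos_quadrant) (\<lambda>p. snd p - fst p)"
      by (intro continuous_intros)
    show "continuous_on UNIV \<psi>" unfolding \<psi>_def by (intro continuous_intros) auto
  next
    fix p assume "p \<in> C a 2 \<inter> pos_quadrant"
    then show "snd p - fst p \<in> UNIV \<and> \<psi> (snd p - fst p) = p"
      by (cases p) (simp add: \<psi>_def mem_C field_simps power2_eq_square)
  next
    fix t :: real
    show "\<psi> t \<in> C a 2 \<inter> pos_quadrant \<and> snd (\<psi> t) - fst (\<psi> t) = t"
      using C[of t] pos[of t] by (simp add: \<psi>_def diff_divide_distrib[symmetric])
    have "F a (\<psi> t) = (snd (\<psi> t), 2 * snd (\<psi> t) + 1 - fst (\<psi> t))"
      using F_affine_on_C[of "fst (\<psi> t)" "snd (\<psi> t)" a 2] C[of t] pos[of t]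
      by (cases "\<psi> t") (auto simp: mem_pos_quadrant)
    then show "t + 1 \<in> UNIV \<and> F a (\<psi> t) = \<psi> (t + 1)"
      by (simp add: \<psi>_def field_simps power2_eq_square)
  qed
  then show ?thesis unfolding conj_to_translation_def by (intro exI[of _ 1]) auto
qed

text \<open>
  Completing the square bounds the distance \<open>|x - c|\<close> on the ellipse: its square is at most
  \<open>4 (c - a) / (4 - h\<^sup>2)\<close>, whereas \<open>c\<^sup>2 = (4 c - 1) / (4 - h\<^sup>2)\<close>. The latter is larger exactly because \<open>a > 1 / 4\<close>.
\<close>

lemma ellipse_in_pos_quadrant:
  assumes a: "a > 1 / 4" and c: "c * (2 - h) = 1" and h: "- 2 < h" "h < 2"
  shows "C a h \<subseteq> pos_quadrant"
proof -
  have "(c\<^sup>2) * (4 - h\<^sup>2) = (c * (2 - h)) * (4 * c - c * (2 - h))"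
    by (simp add: algebra_simps power2_eq_square)
  then have c2: "c\<^sup>2 * (4 - h\<^sup>2) = 4 * c - 1" unfolding c by simp
  have h2: "4 - h\<^sup>2 > 0"
    using h mult_pos_pos[of "2 - h" "2 + h"] by (simp add: algebra_simps power2_eq_square)
  have c0: "c > 0" using c h by (metis diff_gt_0_iff_gt less_numeral_extra(1) zero_less_mult_pos2)
  have *: "u + c > 0" if "u\<^sup>2 + v\<^sup>2 - h * u * v = c - a" for u v
  proof -
    have "u\<^sup>2 * (4 - h\<^sup>2) = 4 * (u\<^sup>2 + v\<^sup>2 - h * u * v) - (2 * v - h * u)\<^sup>2"
      by (simp add: algebra_simps power2_eq_square)
    also have "\<dots> < c\<^sup>2 * (4 - h\<^sup>2)"
    proof -
      have "4 * (c - a) - t\<^sup>2 < 4 * c - 1" for t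
        using a by (simp add: right_diff_distrib add_pos_nonneg less_diff_eq) (smt (verit) zero_le_power2)
      then show ?thesis unfolding that c2 .
    qed
    finally have "u\<^sup>2 < c\<^sup>2" using h2 by simp
    then have "\<bar>u\<bar> < c" using c0 abs_le_square_iff[of c u] by (simp add: not_le[symmetric])
    then show ?thesis by linarith
  qed
  show ?thesis
  proof
    fix P assume "P \<in> C a h"
    moreover obtain x y where P: "P = (x, y)" by (cases P)
    ultimately have Q: "(x - c)\<^sup>2 + (y - c)\<^sup>2 - h * (x - c) * (y - c) = c - a"
      using mem_C_centre[OF c] by simp
    then have "(y - c)\<^sup>2 + (x - c)\<^sup>2 - h * (y - c) * (x - c) = c - a"
      by (simp add: algebra_simps)
    from *[OF Q] *[OF this] show "P \<in> pos_quadrant" by (simp add: P mem_pos_quadrant)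
  qed
qed

text \<open>
  In complex notation the curve is \<open>T z = d + \<i> e + p z + q \<i> cnj z\<close> with \<open>z\<close> on the unit circle. A point
  inside it is \<open>T s\<close> with \<open>|s| < 1\<close>, and \<open>T z - T s = p (z - s) + q \<i> cnj (z - s)\<close>, where the second term is
  smaller than the first. Dropping the second term therefore does not change the winding number,
  and what remains is a circle around \<open>T s\<close>.
\<close>

lemma counterclockwise_affine:
  fixes p q d e :: real
  assumes pq: "\<bar>q\<bar> < p"
  shows "counterclockwise (\<lambda>z. (d + p * Re z + q * Im z, e + q * Re z + p * Im z))"
proof -
  define T where "T = (\<lambda>z. Complex d e + (of_real p * z + \<i> * of_real q * cnj z))"
  define \<gamma> where "\<gamma> = T \<circ> circlepath 0 1"
  have \<gamma>: "(\<lambda>(x, y). Complex x y) \<circ> (\<lambda>z. (d + p * Re z + q * Im z, e + q * Re z + p * Im z)) \<circ>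
      circlepath 0 1 = \<gamma>"
    by (rule ext) (simp add: \<gamma>_def T_def complex_eq_iff)
  have image: "path_image \<gamma> = T ` sphere 0 1"
    unfolding \<gamma>_def path_image_compose by simp
  have lin: "linear (\<lambda>z. of_real p * z + \<i> * of_real q * cnj z)"
    by (intro linearI) (simp_all add: algebra_simps scaleR_conv_of_real)
  have "T ` cball 0 1 = (\<lambda>z. Complex d e + z) ` (\<lambda>z. of_real p * z + \<i> * of_real q * cnj z) ` cball 0 1"
    by (auto simp: T_def image_image)
  then have convex: "convex (T ` cball 0 1)"
    using convex_linear_image[OF lin convex_cball] by (simp add: convex_translation)
  have "winding_number \<gamma> w = 1" if w: "w \<in> inside (path_image \<gamma>)" for w
  proof -
    have "inside (path_image \<gamma>) \<subseteq> T ` cball 0 1"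
      using outside_subset_convex[OF convex, of "path_image \<gamma>"] inside_Int_outside[of "path_image \<gamma>"]
      unfolding image using ball_subset_cball sphere_cball by blast
    then obtain s where s: "w = T s" "norm s \<le> 1" using w by auto
    have "w \<notin> path_image \<gamma>" using w inside_no_overlap[of "path_image \<gamma>"] by blast
    then have s1: "norm s < 1" using s image by (cases "norm s = 1") auto
    define \<delta> where "\<delta> = circlepath (w - of_real p * s) p"
    have \<delta>: "\<delta> t = w + of_real p * (circlepath 0 1 t - s)" for t
      by (simp add: \<delta>_def circlepath algebra_simps)
    have \<gamma>t: "\<gamma> t = \<delta> t + \<i> * of_real q * cnj (circlepath 0 1 t - s)" for t
      by (simp add: \<delta> \<gamma>_def s(1) T_def algebra_simps)
    \<comment> \<open>\<open>\<delta>\<close> is the circle left after dropping the term with \<open>q\<close>, translated so that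
      \<open>\<delta> - w = p (z - s)\<close>.\<close>
    have "winding_number \<gamma> w = winding_number \<delta> w"
    proof (rule winding_number_nearby_loops_eq)
      show "path \<delta>" "pathfinish \<delta> = pathstart \<delta>" by (simp_all add: \<delta>_def)
      show "path \<gamma>" unfolding \<gamma>_def T_def
        by (intro path_continuous_image continuous_intros) simp
      show "pathfinish \<gamma> = pathstart \<gamma>"
        unfolding \<gamma>_def pathfinish_compose pathstart_compose by simp
    next
      fix t :: real assume "t \<in> {0..1}"
      then have "circlepath 0 1 t \<in> path_image (circlepath 0 1)" by (simp add: path_image_def)
      then have "circlepath 0 1 t \<noteq> s" using s1 by auto
      then show "norm (\<gamma> t - \<delta> t) < norm (\<delta> t - w)"
        using pq by (simp add: \<gamma>t \<delta> norm_mult del: complex_cnj_diff)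
    qed
    also have "\<dots> = 1"
    proof -
      have "p * norm s < p * 1" using s1 pq by (intro mult_strict_left_mono) auto
      then have "norm (w - (w - of_real p * s)) < p" using pq by (simp add: norm_mult)
      then show ?thesis unfolding \<delta>_def by (rule winding_number_circlepath)
    qed
    finally show ?thesis .
  qed
  then show ?thesis unfolding counterclockwise_def \<gamma> Let_def by blast
qed

text \<open>
  Orbits on the ellipse have the form \<open>x\<^sub>j = c + A cos (t + j \<theta>)\<close> with \<open>2 cos \<theta> = h\<close>, so that \<open>(x\<^sub>j, x\<^sub>j\<^sub>+\<^sub>1)\<close>
  parametrizes the ellipse. A shift of \<open>t\<close> makes the parametrization symmetric under exchanging \<open>x\<close> with \<open>y\<close>
  and \<open>Re z\<close> with \<open>Im z\<close>, which is the form treated in \<open>counterclockwise_affine\<close>. There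
  \<open>|q| < p\<close> is needed, and it holds because \<open>sin \<theta> < 0\<close>.
\<close>

lemma conj_to_rotation_ellipse:
  assumes a: "a > 1 / 4" and c: "c * (2 - h) = 1" and h: "- 2 < h" "h < 2" and ca: "c > a"
  shows "conj_to_rotation (C a h \<inter> pos_quadrant) (F a)
    (Arg ((of_real h - \<i> * of_real (sqrt (4 - h\<^sup>2))) / 2))"
proof -
  define C' S where "C' = h / 2" and "S = - sqrt (4 - h\<^sup>2) / 2"
  have h2: "4 - h\<^sup>2 > 0"
    using h mult_pos_pos[of "2 - h" "2 + h"] by (simp add: algebra_simps power2_eq_square)
  have S: "S < 0" and CS: "C'\<^sup>2 + S\<^sup>2 = 1" and hC: "h = 2 * C'"
    using h2 by (simp_all add: C'_def S_def power_divide add_divide_distrib[symmetric])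
  define \<theta> where "\<theta> = Arg ((of_real h - \<i> * of_real (sqrt (4 - h\<^sup>2))) / 2)"
  have eq: "(of_real h - \<i> * of_real (sqrt (4 - h\<^sup>2))) / 2 = Complex C' S"
    by (simp add: C'_def S_def complex_eq_iff)
  have "norm (Complex C' S) = 1" using CS by (simp add: cmod_def)
  then have cis: "cis \<theta> = Complex C' S"
    unfolding \<theta>_def eq by (subst cis_Arg) (auto simp: sgn_div_norm)
  \<comment> \<open>The first coordinate of \<open>\<psi> (cis \<theta> * z)\<close> must be the second coordinate of \<open>\<psi> z\<close>: this fixes
    \<open>p : q = (1 - S) : C'\<close>. The scale \<open>\<kappa>\<close> is then determined by the equation of the ellipse.\<close>
  define \<kappa> where "\<kappa> = sqrt ((c - a) / (2 * (1 - S) * S\<^sup>2))"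
  have \<kappa>: "\<kappa> > 0" "\<kappa>\<^sup>2 * (2 * (1 - S) * S\<^sup>2) = c - a"
    using S ca by (simp_all add: \<kappa>_def)
  define p q where "p = \<kappa> * (1 - S)" and "q = \<kappa> * C'"
  have "\<bar>C'\<bar> \<le> 1" using CS abs_le_square_iff[of C' 1] zero_le_power2[of S] by simp
  then have pq: "\<bar>q\<bar> < p" using S \<kappa>(1) by (simp add: p_def q_def abs_mult)
  have D: "p\<^sup>2 - q\<^sup>2 > 0" using pq power_strict_mono[of "\<bar>q\<bar>" p 2] by simp
  have rot: "q = p * C' + q * S" "p = - p * S + q * C'"
  proof -
    have "\<kappa> * (1 - S) * C' + \<kappa> * C' * S = \<kappa> * C'" by (simp add: algebra_simps)
    then show "q = p * C' + q * S" by (simp add: p_def q_def)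
    have "- (\<kappa> * (1 - S)) * S + \<kappa> * C' * C' = \<kappa> * (C'\<^sup>2 + S\<^sup>2 - S)"
      by (simp add: algebra_simps power2_eq_square)
    then show "p = - p * S + q * C'" unfolding CS by (simp add: p_def q_def)
  qed
  define \<psi> where "\<psi> = (\<lambda>z. (c + p * Re z + q * Im z, c + q * Re z + p * Im z))"
  define \<phi> where "\<phi> = (\<lambda>P. of_real ((p * (fst P - c) - q * (snd P - c)) / (p\<^sup>2 - q\<^sup>2)) +
    \<i> * of_real ((p * (snd P - c) - q * (fst P - c)) / (p\<^sup>2 - q\<^sup>2)))"
  have inv1: "\<phi> (\<psi> z) = z" for z
  proof -
    have "p * (p * Re z + q * Im z) - q * (q * Re z + p * Im z) = Re z * (p\<^sup>2 - q\<^sup>2)"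
      "p * (q * Re z + p * Im z) - q * (p * Re z + q * Im z) = Im z * (p\<^sup>2 - q\<^sup>2)"
      by (simp_all add: algebra_simps power2_eq_square)
    then show ?thesis using D by (simp add: \<phi>_def \<psi>_def complex_eq_iff add.assoc)
  qed
  have inv2: "\<psi> (\<phi> P) = P" for P
  proof -
    obtain x y where P: "P = (x, y)" by (cases P)
    have "p * (p * (x - c) - q * (y - c)) + q * (p * (y - c) - q * (x - c)) = (x - c) * (p\<^sup>2 - q\<^sup>2)"
      "q * (p * (x - c) - q * (y - c)) + p * (p * (y - c) - q * (x - c)) = (y - c) * (p\<^sup>2 - q\<^sup>2)"
      by (simp_all add: algebra_simps power2_eq_square)
    then show ?thesis using D
      by (simp add: \<phi>_def \<psi>_def P add.assoc add_divide_distrib[symmetric])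
  qed
  have mem: "\<psi> z \<in> C a h \<longleftrightarrow> norm z = 1" for z
  proof -
    have "(p * Re z + q * Im z)\<^sup>2 + (q * Re z + p * Im z)\<^sup>2
      - h * (p * Re z + q * Im z) * (q * Re z + p * Im z) = (c - a) * ((Re z)\<^sup>2 + (Im z)\<^sup>2)"
    proof -
      have "(p * X + q * Y)\<^sup>2 + (q * X + p * Y)\<^sup>2 - h * (p * X + q * Y) * (q * X + p * Y) =
          (p\<^sup>2 + q\<^sup>2 - 2 * C' * p * q) * (X\<^sup>2 + Y\<^sup>2) + (4 * p * q - 2 * C' * (p\<^sup>2 + q\<^sup>2)) * (X * Y)"
        for X Y by (simp add: hC algebra_simps power2_eq_square)
      moreover have "p\<^sup>2 + q\<^sup>2 = \<kappa>\<^sup>2 * (2 * (1 - S))"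
      proof -
        have "p\<^sup>2 + q\<^sup>2 = \<kappa>\<^sup>2 * ((C'\<^sup>2 + S\<^sup>2) + 1 - 2 * S)"
          by (simp add: p_def q_def algebra_simps power2_eq_square)
        then show ?thesis by (simp add: CS)
      qed
      moreover have "p * q = \<kappa>\<^sup>2 * (1 - S) * C'"
        by (simp add: p_def q_def power2_eq_square)
      moreover have "\<kappa>\<^sup>2 * (2 * (1 - S)) - 2 * C' * (\<kappa>\<^sup>2 * (1 - S) * C') = c - a"
      proof -
        have "\<kappa>\<^sup>2 * (2 * (1 - S)) - 2 * C' * (\<kappa>\<^sup>2 * (1 - S) * C') =
            \<kappa>\<^sup>2 * (2 * (1 - S)) * (1 - C'\<^sup>2)" by (simp add: algebra_simps power2_eq_square)
        moreover have "1 - C'\<^sup>2 = S\<^sup>2" using CS by simp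
        ultimately show ?thesis using \<kappa>(2) by (simp only: mult.assoc)
      qed
      ultimately show ?thesis by (simp add: mult.assoc)
    qed
    then show ?thesis using ca
      by (simp add: \<psi>_def mem_C_centre[OF c] cmod_def add.assoc)
  qed
  have X: "C a h \<inter> pos_quadrant = C a h" using ellipse_in_pos_quadrant[OF a c h] by blast
  have "conjugacy (C a h) (F a) (sphere 0 1) (\<lambda>z. cis \<theta> * z) \<phi> \<psi>"
  proof (rule conjugacy_parametrization)
    show "continuous_on (C a h) \<phi>" unfolding \<phi>_def using D by (intro continuous_intros) auto
    show "continuous_on (sphere 0 1) \<psi>" unfolding \<psi>_def by (intro continuous_intros)
  next
    fix P assume "P \<in> C a h"
    then show "\<phi> P \<in> sphere 0 1 \<and> \<psi> (\<phi> P) = P" using mem[of "\<phi> P"] inv2[of P] by simp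
  next
    fix z :: complex assume z: "z \<in> sphere 0 1"
    then show \<psi>z: "\<psi> z \<in> C a h \<and> \<phi> (\<psi> z) = z" using mem inv1 by simp
    then have "\<psi> z \<in> pos_quadrant" using X by blast
    then have "F a (\<psi> z) = (snd (\<psi> z), h * snd (\<psi> z) + 1 - fst (\<psi> z))"
      using F_affine_on_C[of "fst (\<psi> z)" "snd (\<psi> z)" a h] \<psi>z
      by (cases "\<psi> z") (auto simp: mem_pos_quadrant)
    also have "\<dots> = \<psi> (cis \<theta> * z)"
    proof -
      have 1: "p * (C' * X - S * Y) + q * (C' * Y + S * X) = q * X + p * Y" for X Y
      proof -
        have "p * (C' * X - S * Y) + q * (C' * Y + S * X) =
            (p * C' + q * S) * X + (- p * S + q * C') * Y" by (simp add: algebra_simps)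
        then show ?thesis unfolding rot[symmetric] .
      qed
      have 2: "c + (q * (C' * X - S * Y) + p * (C' * Y + S * X)) =
          h * (c + (q * X + p * Y)) + 1 - (c + (p * X + q * Y))" for X Y
      proof -
        have "h * q - p = q * C' + p * S" "h * p - q = p * C' - q * S" "h * c = 2 * c - 1"
          using rot c by (simp_all add: hC algebra_simps)
        then have "(h * q - p) * X + (h * p - q) * Y + h * c =
            (q * C' + p * S) * X + (p * C' - q * S) * Y + (2 * c - 1)" by simp
        then show ?thesis by (simp add: algebra_simps)
      qed
      show ?thesis using 1 2 by (simp add: \<psi>_def cis add.assoc)
    qed
    finally show "cis \<theta> * z \<in> sphere 0 1 \<and> F a (\<psi> z) = \<psi> (cis \<theta> * z)"
      using z by (simp add: norm_mult)
  qed
  moreover have "counterclockwise \<psi>" unfolding \<psi>_def by (rule counterclockwise_affine[OF pq])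
  ultimately show ?thesis unfolding conj_to_rotation_def X \<theta>_def by blast
qed


section \<open>The hyperbola in the coordinates of its asymptotes\<close>

text \<open>
  The numbers \<open>m\<close> and \<open>n\<close> are the slopes of the asymptotes and at the same time the eigenvalues of the
  linear part of the map, with eigenvectors \<open>(1, m)\<close> and \<open>(1, n)\<close>. All assumptions are symmetric in
  \<open>m\<close> and \<open>n\<close>, so the two points at infinity are obtained from two interpretations of this locale.
\<close>

locale asymptote_slopes =
  fixes a h c k m n :: real
  assumes a: "a > 1 / 4"
    and mult: "m * n = 1" and sum: "m + n = h" and neq: "m \<noteq> n"
    and c: "c * (2 - h) = 1"
    and k: "k * (m - n)\<^sup>2 = a - c"
begin

lemma quadratic_form_factorization: "u\<^sup>2 + v\<^sup>2 - h * u * v = (v - m * u) * (v - n * u)"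
proof -
  have "(v - m * u) * (v - n * u) = (m * n) * u\<^sup>2 + v\<^sup>2 - (m + n) * u * v"
    by (simp add: algebra_simps power2_eq_square)
  then show ?thesis by (simp add: mult sum)
qed

text \<open>
  The quadratic form vanishes on the asymptotic directions, so in coordinates along them only the mixed
  term \<open>r s\<close> survives.
\<close>

lemma conic_asymptote_form:
  assumes "x = c * z + (r + s)" "y = c * z + (m * r + n * s)"
  shows "x\<^sup>2 + y\<^sup>2 - h * x * y - x * z - y * z + a * z\<^sup>2 = 0 \<longleftrightarrow> r * s = k * z\<^sup>2"
proof -
  have "x\<^sup>2 + y\<^sup>2 - h * x * y - x * z - y * z + a * z\<^sup>2 =
      (m * r + n * s - m * (r + s)) * (m * r + n * s - n * (r + s)) - (c - a) * z\<^sup>2"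
    unfolding conic_about_centre[OF c] assms quadratic_form_factorization[symmetric] by simp
  also have "\<dots> = (m - n)\<^sup>2 * (k * z\<^sup>2 - r * s)"
    unfolding minus_diff_eq[of a c, symmetric] k[symmetric]
    by (simp add: algebra_simps power2_eq_square)
  finally show ?thesis using neq by auto
qed

lemma asymptote_coordinates:
  assumes "r = ((y - c * z) - n * (x - c * z)) / (m - n)"
    and "s = (m * (x - c * z) - (y - c * z)) / (m - n)"
  shows "x = c * z + (r + s)" and "y = c * z + (m * r + n * s)"
proof -
  have "r * (m - n) = (y - c * z) - n * (x - c * z)" "s * (m - n) = m * (x - c * z) - (y - c * z)"
    using neq by (simp_all add: assms)
  then have "(m - n) * (x - (c * z + (r + s))) = 0" "(m - n) * (y - (c * z + (m * r + n * s))) = 0"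
    by algebra+
  then show "x = c * z + (r + s)" "y = c * z + (m * r + n * s)" using neq by simp_all
qed

text \<open>
  The left-hand side is the second coordinate of the image under the affine map, in homogeneous form.
  The first coordinate of the image needs no computation: it is \<open>y = c z + (m r + n s)\<close> itself.
\<close>

lemma step_in_asymptote_coordinates:
  "h * (c * z + (m * r + n * s)) + z - (c * z + (r + s)) = c * z + (m * (m * r) + n * (n * s))"
proof -
  have "h * c = 2 * c - 1" using c by (simp add: algebra_simps)
  moreover have "h * (c * z + (m * r + n * s)) + z - (c * z + (r + s)) =
      (h * c) * z + (m + n) * (m * r + n * s) + z - (c * z + (r + s))"
    by (simp add: sum algebra_simps)
  moreover have "(m + n) * (m * r + n * s) = m * (m * r) + n * (n * s) + (m * n) * (r + s)"
    by (simp add: algebra_simps)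
  ultimately show ?thesis by (simp only: mult) (simp add: algebra_simps)
qed

lemma k_pos:
  assumes "h > 2"
  shows "k > 0"
proof -
  have "k * (m - n)\<^sup>2 > 0" using k a centre_neg[OF c assms] by simp
  then show ?thesis using neq by (simp add: zero_less_mult_iff)
qed

text \<open>
  Both coordinates of a point of the branch \<open>r, s > 0\<close> have the form \<open>c + (p + q)\<close> with \<open>p q = k\<close>: take \<open>p = r\<close>,
  \<open>q = s\<close> for the first and \<open>p = m r\<close>, \<open>q = n s\<close> for the second. By the inequality of the means
  \<open>(p + q)\<^sup>2 \<ge> 4 k\<close>, and \<open>4 k > c\<^sup>2\<close> because \<open>(m - n)\<^sup>2 (4 k - c\<^sup>2) = 4 a - 1\<close>.
\<close>

lemma pos_if_product_k:
  assumes "h > 2" "p > 0" "p * q = k"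
  shows "c + (p + q) > 0"
proof -
  have ch: "c * h = 2 * c - 1" using c by (simp add: algebra_simps)
  have d: "(m - n)\<^sup>2 = (h - 2) * (h + 2)"
    using mult by (simp add: sum[symmetric] algebra_simps power2_eq_square)
  have d0: "(m - n)\<^sup>2 > 0" using neq by simp
  have "c\<^sup>2 * (m - n)\<^sup>2 = c * (c * h - 2 * c) * (h + 2)"
    unfolding d by (simp add: algebra_simps power2_eq_square)
  moreover have "c * h - 2 * c = - 1" using ch by simp
  ultimately have "c\<^sup>2 * (m - n)\<^sup>2 = c * (- 1) * (h + 2)" by (simp only:)
  then have "c\<^sup>2 * (m - n)\<^sup>2 = - (c * h) - 2 * c" by (simp add: algebra_simps)
  then have "c\<^sup>2 * (m - n)\<^sup>2 = 1 - 4 * c" using ch by linarith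
  also have "\<dots> < 4 * (a - c)" using a by simp
  also have "\<dots> = 4 * k * (m - n)\<^sup>2" using k by simp
  finally have ck: "c\<^sup>2 < 4 * k" using d0 by simp
  have "q > 0" using k_pos[OF assms(1)] assms(2,3) by (metis zero_less_mult_pos)
  have "4 * (p * q) \<le> (p + q)\<^sup>2"
    using zero_le_power2[of "p - q"] by (simp add: algebra_simps power2_eq_square)
  then have "(- c)\<^sup>2 < (p + q)\<^sup>2" using ck assms(3) by simp
  moreover have "0 \<le> p + q" using \<open>q > 0\<close> assms(2) by simp
  ultimately have "- c < p + q" by (rule power2_less_imp_less)
  then show ?thesis by simp
qed

lemma conj_to_translation_hyperbola:
  assumes h: "h > 2" and m: "m > 1"
  shows "conj_to_translation (C a h \<inter> pos_quadrant) (F a)"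
proof -
  have n1: "n = inverse m" using mult by (simp add: inverse_unique)
  have mn: "m * (n * x) = x" "n * (m * x) = x" for x
    using mult by (simp_all add: mult.assoc[symmetric] mult.commute)
  define \<psi> where "\<psi> = (\<lambda>t. (c + (exp t + k * exp (- t)), c + (m * exp t + n * (k * exp (- t)))))"
  define R where "R = (\<lambda>P. ((snd P - c) - n * (fst P - c)) / (m - n))"
  have C: "\<psi> t \<in> C a h" for t
    using conic_asymptote_form[of "fst (\<psi> t)" 1 "exp t" "k * exp (- t)" "snd (\<psi> t)"]
    by (simp add: \<psi>_def mem_C exp_minus algebra_simps)
  have pos: "\<psi> t \<in> pos_quadrant" for t
    using pos_if_product_k[OF h, of "exp t" "k * exp (- t)"]
      pos_if_product_k[OF h, of "m * exp t" "n * (k * exp (- t))"] m mn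
    by (simp add: \<psi>_def mem_pos_quadrant exp_minus field_simps)
  have R\<psi>: "R (\<psi> t) = exp t" for t
    using neq by (simp add: R_def \<psi>_def field_simps)
  \<comment> \<open>Since \<open>c < 0\<close>, a point with \<open>x > 0\<close> has \<open>r + s > 0\<close>, which together with \<open>r s = k > 0\<close> selects
    the branch \<open>r > 0\<close>.\<close>
  have \<psi>R: "R P > 0 \<and> \<psi> (ln (R P)) = P" if P: "P \<in> C a h \<inter> pos_quadrant" for P
  proof -
    obtain x y where xy: "P = (x, y)" by (cases P)
    define r s where "r = R P" and "s = (m * (x - c * 1) - (y - c * 1)) / (m - n)"
    have rs: "r = R P" "x = c * 1 + (r + s)" "y = c * 1 + (m * r + n * s)"
      using asymptote_coordinates[of r y 1 x s] by (simp_all add: r_def s_def R_def xy)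
    have "x\<^sup>2 + y\<^sup>2 - h * x * y - x * 1 - y * 1 + a * 1\<^sup>2 = 0"
      using P by (simp add: xy mem_C)
    then have prod: "r * s = k" using conic_asymptote_form[OF rs(2,3)] by simp
    have "c < 0" using c h by (rule centre_neg)
    moreover have "x > 0" using P by (simp add: xy mem_pos_quadrant)
    ultimately have "r + s > 0" using rs(2) by linarith
    moreover have "r * s > 0" using prod k_pos[OF h] by simp
    ultimately have r: "r > 0" by (auto simp: zero_less_mult_iff)
    then have "k * exp (- ln r) = s" using prod by (simp add: exp_minus field_simps)
    then have "\<psi> (ln r) = P" using r by (simp only: \<psi>_def exp_ln xy) (simp add: rs(2,3))
    then show ?thesis using r unfolding rs(1) by simp
  qed
  have "conjugacy (C a h \<inter> pos_quadrant) (F a) UNIV (\<lambda>t. t + ln m) (\<lambda>P. ln (R P)) \<psi>"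
  proof (rule conjugacy_parametrization)
    have "continuous_on (C a h \<inter> pos_quadrant) R"
      unfolding R_def using neq by (intro continuous_intros) auto
    then show "continuous_on (C a h \<inter> pos_quadrant) (\<lambda>P. ln (R P))"
      using \<psi>R by (intro continuous_on_ln) force+
    show "continuous_on UNIV \<psi>" unfolding \<psi>_def by (intro continuous_intros)
  next
    fix P assume "P \<in> C a h \<inter> pos_quadrant"
    then show "ln (R P) \<in> UNIV \<and> \<psi> (ln (R P)) = P" using \<psi>R by simp
  next
    fix t :: real
    show "\<psi> t \<in> C a h \<inter> pos_quadrant \<and> ln (R (\<psi> t)) = t" using C pos R\<psi> by simp
    have "F a (\<psi> t) = (snd (\<psi> t), h * snd (\<psi> t) + 1 - fst (\<psi> t))"
      using F_affine_on_C[of "fst (\<psi> t)" "snd (\<psi> t)" a h] C[of t] pos[of t]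
      by (cases "\<psi> t") (auto simp: mem_pos_quadrant)
    also have "\<dots> = (c + (m * exp t + n * (k * exp (- t))),
        c + (m * (m * exp t) + n * (n * (k * exp (- t)))))"
      using step_in_asymptote_coordinates[of 1 "exp t" "k * exp (- t)"] by (simp add: \<psi>_def)
    also have "\<dots> = \<psi> (t + ln m)"
      using m by (simp add: \<psi>_def exp_add exp_diff exp_minus n1 field_simps)
    finally show "t + ln m \<in> UNIV \<and> F a (\<psi> t) = \<psi> (t + ln m)" by simp
  qed
  moreover have "ln m \<noteq> 0" using m by simp
  ultimately show ?thesis unfolding conj_to_translation_def by blast
qed

end

section \<open>The projective map on the projective conic\<close>

lemma proj_plane_cases:
  obtains x y z where "P = proj_pt x y z" "(x, y, z) \<noteq> (0, 0, 0)"
proof -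
  obtain v where v: "proportional v v" "P = abs_proj_plane v"
    using Quotient_abs_rep[OF Quotient_proj_plane] Quotient_rep_reflp[OF Quotient_proj_plane]
    by metis
  obtain x y z where "v = (x, y, z)" by (cases v)
  with v that show thesis by (auto simp: proj_pt_def proportional_def zero_prod_def)
qed

lemma mem_C_proj:
  assumes "(x, y, z) \<noteq> (0, 0, 0)"
  shows "proj_pt x y z \<in> C_proj a h \<longleftrightarrow>
    x\<^sup>2 + y\<^sup>2 - h * x * y - x * z - y * z + a * z\<^sup>2 = 0"
proof
  assume "proj_pt x y z \<in> C_proj a h"
  then obtain x' y' z' where *: "(x', y', z') \<noteq> (0, 0, 0)" "proj_pt x' y' z' = proj_pt x y z"
    "x'\<^sup>2 + y'\<^sup>2 - h * x' * y' - x' * z' - y' * z' + a * z'\<^sup>2 = 0"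
    unfolding C_proj_def mem_Collect_eq by metis
  then obtain d where "x = d * x'" "y = d * y'" "z = d * z'"
    using proj_pt_eq_iff[OF *(1) assms] by auto
  then have "x\<^sup>2 + y\<^sup>2 - h * x * y - x * z - y * z + a * z\<^sup>2 =
      d\<^sup>2 * (x'\<^sup>2 + y'\<^sup>2 - h * x' * y' - x' * z' - y' * z' + a * z'\<^sup>2)"
    by (simp add: algebra_simps power2_eq_square)
  then show "x\<^sup>2 + y\<^sup>2 - h * x * y - x * z - y * z + a * z\<^sup>2 = 0" using *(3) by simp
qed (use assms in \<open>auto simp: C_proj_def\<close>)

lemma mem_at_infty:
  assumes "(x, y, z) \<noteq> (0, 0, 0)"
  shows "proj_pt x y z \<in> at_infty \<longleftrightarrow> z = 0"
proof
  assume "proj_pt x y z \<in> at_infty"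
  then obtain x' y' where *: "(x', y') \<noteq> (0, 0)" "proj_pt x' y' 0 = proj_pt x y z"
    unfolding at_infty_def mem_Collect_eq by metis
  then have "(x', y', 0) \<noteq> (0, 0, 0 :: real)" by auto
  from proj_pt_eq_iff[OF this assms] *(2) show "z = 0" by auto
qed (use assms in \<open>auto simp: at_infty_def\<close>)

text \<open>
  On the conic the middle coordinate \<open>a z\<^sup>2 - y z + y\<^sup>2\<close> equals \<open>x (h y + z - x)\<close>, so the quadratic formula for
  \<^term>\<open>F_proj a\<close> has the common factor \<open>x\<close>; it is nonzero since \<open>a z\<^sup>2 - y z + y\<^sup>2\<close> is
  positive definite and \<open>y = z = 0\<close> at no point of the conic.
\<close>

lemma F_proj_linear_on_C_proj:
  assumes a: "a > 1 / 4" and nz: "(x, y, z) \<noteq> (0, 0, 0)" and mem: "proj_pt x y z \<in> C_proj a h"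
  shows "F_proj a (proj_pt x y z) = proj_pt y (h * y + z - x) z"
    and "(y, h * y + z - x, z) \<noteq> (0, 0, 0)"
    and "F_proj a (proj_pt x y z) \<in> C_proj a h"
proof -
  have Q: "x\<^sup>2 + y\<^sup>2 - h * x * y - x * z - y * z + a * z\<^sup>2 = 0"
    using mem mem_C_proj[OF nz] by simp
  then have eq: "a * z\<^sup>2 - y * z + y\<^sup>2 = x * (h * y + z - x)"
    by (simp add: algebra_simps power2_eq_square)
  have yz: "(y, z) \<noteq> (0, 0)"
  proof
    assume "(y, z) = (0, 0)"
    then show False using Q nz by simp
  qed
  from quadratic_pos[OF a this] have x: "x \<noteq> 0" unfolding eq by auto
  have "(x * y, a * z\<^sup>2 - y * z + y\<^sup>2, x * z) \<noteq> (0, 0, 0)"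
    using quadratic_pos[OF a yz] by auto
  from F_proj_proj_pt[OF nz this]
  have "F_proj a (proj_pt x y z) = proj_pt (x * y) (x * (h * y + z - x)) (x * z)"
    unfolding eq .
  also have "\<dots> = proj_pt y (h * y + z - x) z"
    by (rule sym, subst proj_pt_eq_iff) (use x yz in auto)
  finally show F: "F_proj a (proj_pt x y z) = proj_pt y (h * y + z - x) z" .
  show nz': "(y, h * y + z - x, z) \<noteq> (0, 0, 0)" using yz by auto
  have "y\<^sup>2 + (h * y + z - x)\<^sup>2 - h * y * (h * y + z - x) - y * z - (h * y + z - x) * z + a * z\<^sup>2 =
      x\<^sup>2 + y\<^sup>2 - h * x * y - x * z - y * z + a * z\<^sup>2"
    by (simp add: algebra_simps power2_eq_square)
  then show "F_proj a (proj_pt x y z) \<in> C_proj a h" unfolding F mem_C_proj[OF nz'] using Q by simp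
qed

lemma F_proj_image_C_proj:
  assumes "a > 1 / 4"
  shows "F_proj a ` C_proj a h \<subseteq> C_proj a h"
proof
  fix P assume "P \<in> F_proj a ` C_proj a h"
  then obtain Q where Q: "Q \<in> C_proj a h" "P = F_proj a Q" by blast
  obtain x y z where "Q = proj_pt x y z" "(x, y, z) \<noteq> (0, 0, 0)" by (rule proj_plane_cases)
  with Q show "P \<in> C_proj a h" using F_proj_linear_on_C_proj(3)[OF assms] by simp
qed

text \<open>
  On the conic the map is induced by the invertible matrix \<open>(x, y, z) \<mapsto> (y, h y + z - x, z)\<close>, whose inverse
  \<open>(x, y, z) \<mapsto> (h x + z - y, x, z)\<close> also preserves the quadratic form.
\<close>

lemma bij_betw_F_proj:
  assumes a: "a > 1 / 4"
  shows "bij_betw (F_proj a) (C_proj a h) (C_proj a h)"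
proof (rule bij_betw_imageI)
  show "inj_on (F_proj a) (C_proj a h)"
  proof (rule inj_onI)
    fix P P' assume P: "P \<in> C_proj a h" "P' \<in> C_proj a h" "F_proj a P = F_proj a P'"
    obtain x y z where xyz: "P = proj_pt x y z" "(x, y, z) \<noteq> (0, 0, 0)" by (rule proj_plane_cases)
    obtain x' y' z' where xyz': "P' = proj_pt x' y' z'" "(x', y', z') \<noteq> (0, 0, 0)"
      by (rule proj_plane_cases)
    note L = F_proj_linear_on_C_proj(1,2)[OF a xyz(2) P(1)[unfolded xyz(1)]]
    note L' = F_proj_linear_on_C_proj(1,2)[OF a xyz'(2) P(2)[unfolded xyz'(1)]]
    have "proj_pt y (h * y + z - x) z = proj_pt y' (h * y' + z' - x') z'"
      using P(3) xyz xyz' L L' by simp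
    then obtain d where d: "d \<noteq> 0" "y' = d * y" "h * y' + z' - x' = d * (h * y + z - x)" "z' = d * z"
      using proj_pt_eq_iff[OF L(2) L'(2)] by blast
    then have "x' = d * x" by (simp add: algebra_simps)
    with d show "P = P'" unfolding xyz(1) xyz'(1) proj_pt_eq_iff[OF xyz(2) xyz'(2)] by blast
  qed
  have "P \<in> F_proj a ` C_proj a h" if P: "P \<in> C_proj a h" for P
  proof -
    obtain x y z where xyz: "P = proj_pt x y z" "(x, y, z) \<noteq> (0, 0, 0)" by (rule proj_plane_cases)
    have Q: "x\<^sup>2 + y\<^sup>2 - h * x * y - x * z - y * z + a * z\<^sup>2 = 0"
      using P mem_C_proj[OF xyz(2)] xyz(1) by simp
    have nz: "(h * x + z - y, x, z) \<noteq> (0, 0, 0)" using xyz(2) by auto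
    have "(h * x + z - y)\<^sup>2 + x\<^sup>2 - h * (h * x + z - y) * x - (h * x + z - y) * z - x * z + a * z\<^sup>2 =
        x\<^sup>2 + y\<^sup>2 - h * x * y - x * z - y * z + a * z\<^sup>2"
      by (simp add: algebra_simps power2_eq_square)
    then have mem: "proj_pt (h * x + z - y) x z \<in> C_proj a h"
      unfolding mem_C_proj[OF nz] using Q by simp
    have "F_proj a (proj_pt (h * x + z - y) x z) = P"
      unfolding F_proj_linear_on_C_proj(1)[OF a nz mem] xyz(1) by simp
    then show ?thesis using mem by blast
  qed
  then show "F_proj a ` C_proj a h = C_proj a h" using F_proj_image_C_proj[OF a] by blast
qed

lemma tendsto_proj_pt:
  assumes "(f \<longlongrightarrow> x) L" "(g \<longlongrightarrow> y) L" "(i \<longlongrightarrow> z) L" "(x, y, z) \<noteq> (0, 0, 0)"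
  shows "((\<lambda>t. proj_pt (f t) (g t) (i t)) \<longlongrightarrow> proj_pt x y z) L"
proof (rule topological_tendstoI)
  fix S :: "proj_plane set" assume S: "open S" "proj_pt x y z \<in> S"
  define W where "W = {v. v \<noteq> 0 \<and> abs_proj_plane v \<in> S}"
  have "open W" using S(1) by (simp add: W_def open_proj_plane_def)
  moreover have "(x, y, z) \<in> W" using S(2) assms(4) by (auto simp: W_def proj_pt_def zero_prod_def)
  moreover have "((\<lambda>t. (f t, g t, i t)) \<longlongrightarrow> (x, y, z)) L"
    using assms(1-3) by (intro tendsto_Pair)
  ultimately have "eventually (\<lambda>t. (f t, g t, i t) \<in> W) L" by (simp add: topological_tendstoD)
  then show "eventually (\<lambda>t. proj_pt (f t) (g t) (i t) \<in> S) L"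
    by (rule eventually_mono) (simp add: W_def proj_pt_def)
qed

text \<open>
  A homogeneous open condition defines an open set of the projective plane; this is how the neighbourhoods
  of the points at infinity are produced.
\<close>

lemma open_proj_set:
  assumes "open {(x, y, z). A x y z}"
    and "\<And>x y z d. d \<noteq> 0 \<Longrightarrow> A (d * x) (d * y) (d * z) \<longleftrightarrow> A x y z"
  shows "open {proj_pt x y z | x y z. (x, y, z) \<noteq> (0, 0, 0) \<and> A x y z}" (is "open ?U")
proof -
  define U where "U = ?U"
  have mem: "proj_pt x y z \<in> U \<longleftrightarrow> A x y z" if nz: "(x, y, z) \<noteq> (0, 0, 0)" for x y z
  proof
    assume "proj_pt x y z \<in> U"
    then obtain x' y' z' where *: "(x', y', z') \<noteq> (0, 0, 0)" "A x' y' z'"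
      "proj_pt x' y' z' = proj_pt x y z" unfolding U_def mem_Collect_eq by metis
    then show "A x y z" using proj_pt_eq_iff[OF *(1) nz] assms(2) by auto
  qed (use nz in \<open>auto simp: U_def\<close>)
  have "v \<noteq> 0 \<and> abs_proj_plane v \<in> U \<longleftrightarrow> v \<in> - {0} \<inter> {(x, y, z). A x y z}" for v
  proof -
    obtain x y z where v: "v = (x, y, z)" by (cases v)
    have "v = 0 \<longleftrightarrow> (x, y, z) = (0, 0, 0)" by (simp add: v zero_prod_def)
    moreover have "v \<in> {(x, y, z). A x y z} \<longleftrightarrow> A x y z" by (simp add: v)
    moreover have "abs_proj_plane v = proj_pt x y z" by (simp add: v proj_pt_def)
    ultimately show ?thesis using mem[of x y z] by auto
  qed
  then have "{v. v \<noteq> 0 \<and> abs_proj_plane v \<in> U} = - {0} \<inter> {(x, y, z). A x y z}"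
    by (intro set_eqI) (simp only: mem_Collect_eq)
  then show ?thesis unfolding open_proj_plane_def U_def[symmetric]
    using assms(1) by (simp add: open_Int open_Compl)
qed

text \<open>
  The map \<open>G\<close> parametrizes \<open>X\<close> near the fixed point by a real number which the dynamics multiplies by \<open>\<mu>\<close>.
  The last assumption replaces continuity of an inverse chart: all points of \<open>X\<close> sufficiently near
  \<open>G 0\<close> have a small parameter.
\<close>

lemma attractor_via_chart:
  fixes G :: "real \<Rightarrow> 'a::topological_space"
  assumes maps: "f ` X \<subseteq> X" and G0: "G 0 \<in> X" and cont: "(G \<longlongrightarrow> G 0) (nhds 0)"
    and step: "\<And>w. f (G w) = G (\<mu> * w)" and \<mu>: "\<bar>\<mu>\<bar> < 1"
    and chart: "\<And>e. e > 0 \<Longrightarrow> \<exists>U. open U \<and> G 0 \<in> U \<and> (\<forall>q\<in>X \<inter> U. \<exists>w. \<bar>w\<bar> < e \<and> q = G w)"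
  shows "attractor X f (G 0)"
proof -
  have iter: "(f ^^ n) (G w) = G (\<mu> ^ n * w)" for n w
    by (induction n) (simp_all add: step mult.assoc)
  have stable: "\<exists>U. open U \<and> G 0 \<in> U \<and> (\<forall>q\<in>X \<inter> U. \<forall>n. (f ^^ n) q \<in> V)"
    if V: "open V" "G 0 \<in> V" for V
  proof -
    have "eventually (\<lambda>w. G w \<in> V) (nhds 0)" using cont V by (simp add: topological_tendstoD)
    then obtain e where e: "e > 0" "\<And>w. \<bar>w\<bar> < e \<Longrightarrow> G w \<in> V"
      unfolding eventually_nhds_metric by (auto simp: dist_real_def)
    obtain U where U: "open U" "G 0 \<in> U" "\<forall>q\<in>X \<inter> U. \<exists>w. \<bar>w\<bar> < e \<and> q = G w"
      using chart[OF e(1)] by blast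
    have "(f ^^ n) q \<in> V" if q: "q \<in> X \<inter> U" for q n
    proof -
      obtain w where w: "\<bar>w\<bar> < e" "q = G w" using U(3) q by blast
      have "\<bar>\<mu> ^ n * w\<bar> \<le> 1 * \<bar>w\<bar>"
        unfolding abs_mult power_abs using \<mu> by (intro mult_right_mono power_le_one) auto
      then show ?thesis using e(2)[of "\<mu> ^ n * w"] w by (simp add: iter)
    qed
    with U show ?thesis by blast
  qed
  obtain U where U: "open U" "G 0 \<in> U" "\<forall>q\<in>X \<inter> U. \<exists>w. \<bar>w\<bar> < 1 \<and> q = G w"
    using chart[of 1] by auto
  have "(\<lambda>n. (f ^^ n) q) \<longlonglongrightarrow> G 0" if q: "q \<in> X \<inter> U" for q
  proof -
    obtain w where w: "q = G w" using U(3) q by blast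
    have "(\<lambda>n. \<mu> ^ n * w) \<longlonglongrightarrow> 0 * w"
      using \<mu> by (intro tendsto_mult LIMSEQ_power_zero tendsto_const) simp
    then show ?thesis unfolding w iter using cont by (intro filterlim_compose[OF cont]) simp
  qed
  with U stable show ?thesis
    unfolding attractor_def using maps G0 step[of 0] by auto
qed

context asymptote_slopes
begin

text \<open>
  The point with asymptote coordinates \<open>r = 1\<close>, \<open>s = k w\<^sup>2\<close> and \<open>z = w\<close>, that is, the point \<open>r = 1 / w\<close> of the
  affine branches rescaled so that it extends over the point at infinity \<open>w = 0\<close>. The factor \<open>m * 1\<close> keeps the
  shape \<open>m * r + n * s\<close> of the general asymptote coordinates.
\<close>

definition chart :: "real \<Rightarrow> proj_plane" where
  "chart w = proj_pt (c * w + (1 + k * w\<^sup>2)) (c * w + (m * 1 + n * (k * w\<^sup>2))) w"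

lemma chart_nonzero: "(c * w + (1 + k * w\<^sup>2), c * w + (m * 1 + n * (k * w\<^sup>2)), w) \<noteq> (0, 0, 0)"
  by auto

lemma chart_in_C_proj: "chart w \<in> C_proj a h"
  unfolding chart_def mem_C_proj[OF chart_nonzero] 
  by (rule conic_asymptote_form[where r = 1 and s = "k * w\<^sup>2", OF refl refl, THEN iffD2]) simp

lemma F_proj_chart: "F_proj a (chart w) = chart (n * w)"
proof -
  define x y where "x = c * w + (1 + k * w\<^sup>2)" and "y = c * w + (m * 1 + n * (k * w\<^sup>2))"
  have nz: "(x, y, w) \<noteq> (0, 0, 0)" unfolding x_def y_def by (rule chart_nonzero)
  have "proj_pt x y w \<in> C_proj a h" using chart_in_C_proj[of w] by (simp add: chart_def x_def y_def)
  note L = F_proj_linear_on_C_proj(1,2)[OF a nz this]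
  have mn: "m * (n * x) = x" "n * (m * x) = x" for x
    using mult by (simp_all add: mult.assoc[symmetric] mult.commute)
  have y': "h * y + w - x = c * w + (m * (m * 1) + n * (n * (k * w\<^sup>2)))"
    unfolding x_def y_def by (rule step_in_asymptote_coordinates)
  have "F_proj a (chart w) = proj_pt y (h * y + w - x) w"
    using L(1) by (simp add: chart_def x_def y_def)
  also have "\<dots> = chart (n * w)"
    unfolding chart_def proj_pt_eq_iff[OF L(2) chart_nonzero] unfolding y'
    by (intro exI[of _ n]) (use mult in \<open>auto simp: y_def algebra_simps power2_eq_square mn\<close>)
  finally show ?thesis .
qed

lemma chart_tendsto: "(chart \<longlongrightarrow> chart 0) (nhds 0)"
  unfolding chart_def by (intro tendsto_proj_pt tendsto_intros) (auto simp: tendsto_ident_at filterlim_ident)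

lemma chart_zero: "chart 0 = proj_pt 2 (2 * m) 0"
  unfolding chart_def by (subst proj_pt_eq_iff) auto

text \<open>
  The parameter of a point is \<open>w = z / r\<close>, a quotient of two linear forms, so \<open>|w| < e\<close> is the homogeneous
  open condition \<open>|z| < e |r|\<close>.
\<close>

lemma chart_neighbourhood:
  assumes "e > 0"
  shows "\<exists>U. open U \<and> chart 0 \<in> U \<and> (\<forall>P\<in>C_proj a h \<inter> U. \<exists>w. \<bar>w\<bar> < e \<and> P = chart w)"
proof -
  define R where "R = (\<lambda>x y z. ((y - c * z) - n * (x - c * z)) / (m - n))"
  define U where "U = {proj_pt x y z | x y z. (x, y, z) \<noteq> (0, 0, 0) \<and> \<bar>z\<bar> < e * \<bar>R x y z\<bar>}"
  have "open U" unfolding U_def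
  proof (rule open_proj_set)
    have "open {p :: real \<times> real \<times> real. \<bar>snd (snd p)\<bar> < e * \<bar>R (fst p) (fst (snd p)) (snd (snd p))\<bar>}"
      unfolding R_def using neq by (intro open_Collect_less continuous_intros) auto
    moreover have "{(x, y, z). \<bar>z\<bar> < e * \<bar>R x y z\<bar>} =
        {p. \<bar>snd (snd p)\<bar> < e * \<bar>R (fst p) (fst (snd p)) (snd (snd p))\<bar>}" by auto
    ultimately show "open {(x, y, z). \<bar>z\<bar> < e * \<bar>R x y z\<bar>}" by simp
  next
    fix x y z d :: real assume d: "d \<noteq> 0"
    have "R (d * x) (d * y) (d * z) = d * R x y z"
      by (simp add: R_def algebra_simps diff_divide_distrib add_divide_distrib)
    then have eq: "e * \<bar>R (d * x) (d * y) (d * z)\<bar> = \<bar>d\<bar> * (e * \<bar>R x y z\<bar>)" by (simp add: abs_mult)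
    show "\<bar>d * z\<bar> < e * \<bar>R (d * x) (d * y) (d * z)\<bar> \<longleftrightarrow> \<bar>z\<bar> < e * \<bar>R x y z\<bar>"
      unfolding eq abs_mult using d by simp
  qed
  moreover have "chart 0 \<in> U"
  proof -
    have "R 1 m 0 = 1" using neq by (simp add: R_def)
    then have "proj_pt 1 m 0 \<in> U"
      unfolding U_def mem_Collect_eq
      by (intro exI[of _ 1] exI[of _ m] exI[of _ 0]) (use assms in auto)
    then show ?thesis by (simp add: chart_def)
  qed
  moreover have "\<exists>w. \<bar>w\<bar> < e \<and> P = chart w" if P: "P \<in> C_proj a h \<inter> U" for P
  proof -
    obtain x y z where xyz: "P = proj_pt x y z" "(x, y, z) \<noteq> (0, 0, 0)" "\<bar>z\<bar> < e * \<bar>R x y z\<bar>"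
      using P by (auto simp: U_def)
    define r s where "r = R x y z" and "s = (m * (x - c * z) - (y - c * z)) / (m - n)"
    have rs: "r = R x y z" "x = c * z + (r + s)" "y = c * z + (m * r + n * s)"
      using asymptote_coordinates[of r y z x s] by (simp_all only: r_def s_def R_def)
    have r: "r \<noteq> 0" using xyz(3) rs(1) by auto
    have "r * s = k * z\<^sup>2"
      using P xyz(1) mem_C_proj[OF xyz(2)] conic_asymptote_form[OF rs(2,3)] by simp
    then have s: "s = r * (k * (z / r)\<^sup>2)" using r by (simp add: field_simps power2_eq_square)
    have "P = chart (z / r)"
      unfolding xyz(1) chart_def
    proof (subst eq_commute, subst proj_pt_eq_iff[OF chart_nonzero xyz(2)], intro exI[of _ r] conjI)
      show "x = r * (c * (z / r) + (1 + k * (z / r)\<^sup>2))"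
        unfolding rs(2) s using r by (simp add: algebra_simps)
      show "y = r * (c * (z / r) + (m * 1 + n * (k * (z / r)\<^sup>2)))"
        unfolding rs(3) s using r by (simp add: algebra_simps)
    qed (use r in auto)
    moreover have "\<bar>z / r\<bar> < e" using xyz(3) r rs(1) by (simp add: field_simps)
    ultimately show ?thesis by blast
  qed
  ultimately show ?thesis by blast
qed

lemma attractor_forward:
  assumes "\<bar>n\<bar> < 1"
  shows "attractor (C_proj a h) (F_proj a) (chart 0)"
  using F_proj_image_C_proj[OF a] chart_in_C_proj chart_tendsto F_proj_chart assms chart_neighbourhood
  by (rule attractor_via_chart)

lemma repeller_backward:
  assumes "\<bar>m\<bar> < 1"
  shows "repeller (C_proj a h) (F_proj a) (chart 0)"
proof -
  note bij = bij_betw_F_proj[OF a, of h]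
  have "inv_into (C_proj a h) (F_proj a) (chart w) = chart (m * w)" for w
  proof -
    have "F_proj a (chart (m * w)) = chart w"
      using mult by (simp add: F_proj_chart mult.assoc[symmetric] mult.commute)
    then show ?thesis using bij chart_in_C_proj
      by (metis bij_betw_imp_inj_on inv_into_f_f)
  qed
  moreover have "inv_into (C_proj a h) (F_proj a) ` C_proj a h \<subseteq> C_proj a h"
    using bij_betw_inv_into[OF bij] by (simp add: bij_betw_def)
  ultimately have "attractor (C_proj a h) (inv_into (C_proj a h) (F_proj a)) (chart 0)"
    using chart_in_C_proj chart_tendsto assms chart_neighbourhood by (intro attractor_via_chart)
  with bij show ?thesis by (simp add: repeller_def)
qed

text \<open>
  A point of the conic at infinity is an asymptotic direction, and both of these are values of a chart at \<open>0\<close>,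
  where the map fixes the parameter.
\<close>

lemma fixed_points_at_infty:
  "{P \<in> C_proj a h \<inter> at_infty. F_proj a P = P} = {proj_pt 2 (2 * m) 0, proj_pt 2 (2 * n) 0}"
proof (intro equalityI subsetI)
  fix P assume P: "P \<in> {P \<in> C_proj a h \<inter> at_infty. F_proj a P = P}"
  obtain x y z where xyz: "P = proj_pt x y z" "(x, y, z) \<noteq> (0, 0, 0)" by (rule proj_plane_cases)
  have z: "z = 0" using P xyz(1) mem_at_infty[OF xyz(2)] by simp
  then have "(y - m * x) * (y - n * x) = 0"
    using P xyz(1) mem_C_proj[OF xyz(2)] quadratic_form_factorization[of x y] by simp
  then have "y = m * x \<or> y = n * x" by auto
  moreover have "x \<noteq> 0" using calculation z xyz(2) by auto
  then have "proj_pt x (l * x) 0 = proj_pt 2 (2 * l) 0" for l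
    by (subst proj_pt_eq_iff) (auto intro!: exI[of _ "2 / x"])
  ultimately show "P \<in> {proj_pt 2 (2 * m) 0, proj_pt 2 (2 * n) 0}"
    unfolding xyz(1) z by auto
next
  interpret flip: asymptote_slopes a h c k n m
    using a mult sum neq c k
    by unfold_locales (auto simp: mult.commute add.commute power2_commute)
  fix P assume "P \<in> {proj_pt 2 (2 * m) 0, proj_pt 2 (2 * n) 0}"
  then have P: "P = chart 0 \<or> P = flip.chart 0" unfolding chart_zero flip.chart_zero by simp
  then have "P \<in> at_infty"
    unfolding chart_zero flip.chart_zero by (auto simp: mem_at_infty)
  then show "P \<in> {P \<in> C_proj a h \<inter> at_infty. F_proj a P = P}"
    using P chart_in_C_proj flip.chart_in_C_proj F_proj_chart[of 0] flip.F_proj_chart[of 0] by auto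
qed

end

section \<open>The parabola at infinity\<close>

lemma C_proj_parabola_at_infty: "C_proj a 2 \<inter> at_infty = {proj_pt 1 1 0}"
proof (intro equalityI subsetI)
  fix P assume P: "P \<in> C_proj a 2 \<inter> at_infty"
  obtain x y z where xyz: "P = proj_pt x y z" "(x, y, z) \<noteq> (0, 0, 0)" by (rule proj_plane_cases)
  have z: "z = 0" using P xyz(1) mem_at_infty[OF xyz(2)] by simp
  then have "(x - y)\<^sup>2 = 0"
    using P xyz(1) mem_C_proj[OF xyz(2)] by (simp add: power2_diff)
  then show "P \<in> {proj_pt 1 1 0}" unfolding singleton_iff xyz(1)
    by (subst proj_pt_eq_iff) (use z xyz(2) in \<open>auto intro!: exI[of _ "1 / x"]\<close>)
next
  fix P assume "P \<in> {proj_pt 1 1 0}"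
  then show "P \<in> C_proj a 2 \<inter> at_infty" by (simp add: mem_C_proj mem_at_infty)
qed

lemma global_attractor_parabola:
  assumes a: "a > 1 / 4"
  shows "global_attractor (C_proj a 2) (F_proj a) (proj_pt 1 1 0)"
proof -
  define \<psi> where "\<psi> = (\<lambda>d. proj_pt (d\<^sup>2 - d + a) (d\<^sup>2 + d + a) 2)"
  have step: "F_proj a (\<psi> d) = \<psi> (d + 1)" for d
  proof -
    have nz: "(d\<^sup>2 - d + a, d\<^sup>2 + d + a, 2) \<noteq> (0, 0, 0 :: real)" by simp
    have mem: "proj_pt (d\<^sup>2 - d + a) (d\<^sup>2 + d + a) 2 \<in> C_proj a 2"
      unfolding mem_C_proj[OF nz] by (simp add: algebra_simps power2_eq_square)
    show ?thesis unfolding \<psi>_def F_proj_linear_on_C_proj(1)[OF a nz mem]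
      by (simp add: algebra_simps power2_eq_square)
  qed
  have iter: "(F_proj a ^^ n) (\<psi> d) = \<psi> (d + real n)" for n d
    by (induction n) (simp_all add: step add_ac)
  have lim: "(\<psi> \<longlongrightarrow> proj_pt 1 1 0) at_top"
  proof -
    \<comment> \<open>Division of the homogeneous coordinates by \<open>d\<^sup>2\<close> makes the limit visible.\<close>
    have "((\<lambda>d. proj_pt (1 - inverse d + a * (inverse d)\<^sup>2) (1 + inverse d + a * (inverse d)\<^sup>2)
        (2 * (inverse d)\<^sup>2)) \<longlongrightarrow> proj_pt (1 - 0 + a * 0\<^sup>2) (1 + 0 + a * 0\<^sup>2) (2 * 0\<^sup>2)) at_top"
      by (intro tendsto_proj_pt tendsto_intros tendsto_inverse_0_at_top filterlim_ident) auto
    moreover have "eventually (\<lambda>d. proj_pt (1 - inverse d + a * (inverse d)\<^sup>2)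
        (1 + inverse d + a * (inverse d)\<^sup>2) (2 * (inverse d)\<^sup>2) = \<psi> d) at_top"
      using eventually_gt_at_top[of 0]
    proof eventually_elim
      case (elim d)
      then show ?case unfolding \<psi>_def
        by (subst proj_pt_eq_iff) (auto intro!: exI[of _ "d\<^sup>2"] simp: field_simps power2_eq_square)
    qed
    ultimately show ?thesis by (simp add: tendsto_cong)
  qed
  have inf: "proj_pt 1 1 0 \<in> C_proj a 2" by (simp add: mem_C_proj)
  have fixed: "F_proj a (proj_pt 1 1 0) = proj_pt 1 1 0"
    using F_proj_linear_on_C_proj(1)[OF a _ inf] by simp
  have "(\<lambda>n. (F_proj a ^^ n) P) \<longlonglongrightarrow> proj_pt 1 1 0" if P: "P \<in> C_proj a 2" for P
  proof (cases "P \<in> at_infty")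
    case True
    then have "P = proj_pt 1 1 0" using P C_proj_parabola_at_infty by blast
    moreover have "(F_proj a ^^ n) (proj_pt 1 1 0) = proj_pt 1 1 0" for n
      by (induction n) (simp_all add: fixed)
    ultimately show ?thesis by simp
  next
    case False
    obtain x y z where xyz: "P = proj_pt x y z" "(x, y, z) \<noteq> (0, 0, 0)" by (rule proj_plane_cases)
    have z: "z \<noteq> 0" using False xyz(1) mem_at_infty[OF xyz(2)] by simp
    have Q: "x\<^sup>2 + y\<^sup>2 - 2 * x * y - x * z - y * z + a * z\<^sup>2 = 0"
      using P xyz(1) mem_C_proj[OF xyz(2)] by simp
    have "P = \<psi> ((y - x) / z)"
      unfolding xyz(1) \<psi>_def
    proof (subst proj_pt_eq_iff, goal_cases)
      case 3
      have "2 * x * z = (y - x)\<^sup>2 - (y - x) * z + a * z\<^sup>2" "2 * y * z = (y - x)\<^sup>2 + (y - x) * z + a * z\<^sup>2"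
        using Q by (simp_all add: algebra_simps power2_eq_square)
      moreover have "(t\<^sup>2 - t * z + a * z\<^sup>2) / z\<^sup>2 = (t / z)\<^sup>2 - t / z + a"
        "(t\<^sup>2 + t * z + a * z\<^sup>2) / z\<^sup>2 = (t / z)\<^sup>2 + t / z + a" for t
        using z by (simp_all add: field_simps power2_eq_square)
      ultimately have "(2 * x * z) / z\<^sup>2 = ((y - x) / z)\<^sup>2 - (y - x) / z + a"
        "(2 * y * z) / z\<^sup>2 = ((y - x) / z)\<^sup>2 + (y - x) / z + a"
        by (simp_all only:)
      then show ?case using z
        by (intro exI[of _ "2 / z"]) (simp add: power2_eq_square)
    qed (use xyz in auto)
    moreover have "(\<lambda>n. \<psi> ((y - x) / z + real n)) \<longlonglongrightarrow> proj_pt 1 1 0"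
      by (intro filterlim_compose[OF lim] filterlim_tendsto_add_at_top[OF tendsto_const]
          filterlim_real_sequentially)
    ultimately show ?thesis by (simp add: iter)
  qed
  then show ?thesis unfolding global_attractor_def
    using F_proj_image_C_proj[OF a] inf fixed by blast
qed

section \<open>The dynamics on each type of conic\<close>

theorem proposition8:
  fixes a h :: real
  assumes "a > 1 / 4" and "h > 2 - 1 / a"
  shows "(h > 2 \<longrightarrow>
            is_hyperbola (C a h) \<and>
            conj_to_translation (C a h \<inter> pos_quadrant) (F a) \<and>
            {P \<in> C_proj a h \<inter> at_infty. F_proj a P = P} =
              {proj_pt 2 (h + sqrt (h\<^sup>2 - 4)) 0, proj_pt 2 (h - sqrt (h\<^sup>2 - 4)) 0} \<and>
            proj_pt 2 (h + sqrt (h\<^sup>2 - 4)) 0 \<noteq> proj_pt 2 (h - sqrt (h\<^sup>2 - 4)) 0 \<and>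
            attractor (C_proj a h) (F_proj a) (proj_pt 2 (h + sqrt (h\<^sup>2 - 4)) 0) \<and>
            repeller (C_proj a h) (F_proj a) (proj_pt 2 (h - sqrt (h\<^sup>2 - 4)) 0)) \<and>
         (h = 2 \<longrightarrow>
            is_parabola (C a h) \<and>
            conj_to_translation (C a h \<inter> pos_quadrant) (F a) \<and>
            C_proj a h \<inter> at_infty = {proj_pt 1 1 0} \<and>
            global_attractor (C_proj a h) (F_proj a) (proj_pt 1 1 0)) \<and>
         (h < 2 \<longrightarrow>
            is_ellipse (C a h) \<and>
            conj_to_rotation (C a h \<inter> pos_quadrant) (F a)
              (Arg ((of_real h - \<i> * of_real (sqrt (4 - h\<^sup>2))) / 2)))"
proof (intro conjI[of "_ \<longrightarrow> _"] impI)
  assume h: "h > 2"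
  define c where "c = 1 / (2 - h)"
  have c: "c * (2 - h) = 1" using h by (simp add: c_def)
  define m n where "m = (h + sqrt (h\<^sup>2 - 4)) / 2" and "n = (h - sqrt (h\<^sup>2 - 4)) / 2"
  have "h\<^sup>2 - 4 > 0"
    using h mult_pos_pos[of "h - 2" "h + 2"] by (simp add: algebra_simps power2_eq_square)
  then have sqrt: "sqrt (h\<^sup>2 - 4) > 0" "(sqrt (h\<^sup>2 - 4))\<^sup>2 = h\<^sup>2 - 4" by simp_all
  have m: "1 < m" using add_strict_mono[OF h sqrt(1)] by (simp add: m_def)
  have sum: "m + n = h" and gt: "n < m"
    using sqrt(1) by (simp_all add: m_def n_def field_simps)
  have "m * n = (h\<^sup>2 - (sqrt (h\<^sup>2 - 4))\<^sup>2) / 4"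
    by (simp add: m_def n_def algebra_simps power2_eq_square)
  then have mult: "m * n = 1" unfolding sqrt(2) by simp
  have "n > 0" using mult m by (metis less_trans zero_less_mult_pos zero_less_one)
  then have n: "\<bar>n\<bar> < 1" using mult m mult_strict_left_mono[of 1 m n] by (simp add: mult.commute)
  have eqs: "h + sqrt (h\<^sup>2 - 4) = 2 * m" "h - sqrt (h\<^sup>2 - 4) = 2 * n" by (simp_all add: m_def n_def)
  interpret A: asymptote_slopes a h c "(a - c) / (m - n)\<^sup>2" m n
    using assms(1) mult sum gt c by unfold_locales auto
  interpret R: asymptote_slopes a h c "(a - c) / (m - n)\<^sup>2" n m
    using assms(1) mult sum gt c
    by unfold_locales (auto simp: mult.commute add.commute power2_commute)
  have "is_hyperbola (C a h)" using is_hyperbola_C[OF c h] centre_neg[OF c h] assms(1) by simp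
  moreover have "proj_pt 2 (2 * m) 0 \<noteq> proj_pt 2 (2 * n) 0"
    using gt by (subst proj_pt_eq_iff) auto
  ultimately show "is_hyperbola (C a h) \<and>
      conj_to_translation (C a h \<inter> pos_quadrant) (F a) \<and>
      {P \<in> C_proj a h \<inter> at_infty. F_proj a P = P} =
        {proj_pt 2 (h + sqrt (h\<^sup>2 - 4)) 0, proj_pt 2 (h - sqrt (h\<^sup>2 - 4)) 0} \<and>
      proj_pt 2 (h + sqrt (h\<^sup>2 - 4)) 0 \<noteq> proj_pt 2 (h - sqrt (h\<^sup>2 - 4)) 0 \<and>
      attractor (C_proj a h) (F_proj a) (proj_pt 2 (h + sqrt (h\<^sup>2 - 4)) 0) \<and>
      repeller (C_proj a h) (F_proj a) (proj_pt 2 (h - sqrt (h\<^sup>2 - 4)) 0)"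
    unfolding eqs A.chart_zero[symmetric] R.chart_zero[symmetric]
    using A.conj_to_translation_hyperbola[OF h m] A.fixed_points_at_infty
      A.attractor_forward[OF n] R.repeller_backward[OF n]
    by (simp add: A.chart_zero R.chart_zero)
next
  assume "h = 2"
  then show "is_parabola (C a h) \<and>
      conj_to_translation (C a h \<inter> pos_quadrant) (F a) \<and>
      C_proj a h \<inter> at_infty = {proj_pt 1 1 0} \<and>
      global_attractor (C_proj a h) (F_proj a) (proj_pt 1 1 0)"
    using is_parabola_C conj_to_translation_parabola C_proj_parabola_at_infty
      global_attractor_parabola assms(1) by simp
next
  assume h: "h < 2"
  define c where "c = 1 / (2 - h)"
  have c: "c * (2 - h) = 1" using h by (simp add: c_def)
  have "1 / a < 4" using assms(1) by (simp add: field_simps)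
  then have h': "- 2 < h" using assms(2) by linarith
  have "a * (2 - h) < 1" using assms by (simp add: field_simps)
  then have "c > a" using c h mult_less_cancel_right_pos[of "2 - h" a c] by simp
  then show "is_ellipse (C a h) \<and>
      conj_to_rotation (C a h \<inter> pos_quadrant) (F a)
        (Arg ((of_real h - \<i> * of_real (sqrt (4 - h\<^sup>2))) / 2))"
    using is_ellipse_C[OF c h' h] conj_to_rotation_ellipse[OF assms(1) c h' h] by blast
qed

end
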